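(* Let $\mathscr G$ be an ample groupoid and suppose that there is a strongly faithful invariant mean on $\mathscr G^{(0)}$. Then $K\mathscr G$ is stably finite for all integral domains $K$ of characteristic zero.
   Context: Rings are not assumed unital. A ring $R$ is Dedekind finite if for every idempotent $e\in R$ and all $u,v\in eRe$, $uv=e$ implies $vu=e$; $R$ is stably finite if $M_n(R)$ is Dedekind finite for all $n\geq 1$. A groupoid $\mathscr G$ is identified with its set of arrows, objects being identified with identity arrows; $\mathscr G^{(0)}$ is the unit space, $\boldsymbol d(\gamma)=\gamma^{-1}\gamma$, $\boldsymbol r(\gamma)=\gamma\gamma^{-1}$. A topological groupoid is étale if $\boldsymbol d$ is a local homeomorphism. An ample groupoid is an étale groupoid whose unit space is Hausdorff with a basis of compact open sets ($\mathscr G$ itself need not be Hausdorff). A bisection is an open subset $U\subseteq\mathscr G$ on which $\boldsymbol d$ and $\boldsymbol r$ are injective; $\Gamma(\mathscr G)$ (resp. $\Gamma_c(\mathscr G)$) is the set of open (resp. compact open) bisections, with setwise product and inverse, and $\Gamma_c(\mathscr G^{(0)})$ is the set of compact open subsets of $\mathscr G^{(0)}$. For a commutative unital ring $K$, $K\mathscr G$ is the $K$-span, inside the functions $\mathscr G\to K$, of the indicator functions $1_U$, $U\in\Gamma_c(\mathscr G)$, with convolution product $(f\ast g)(\gamma)=\sum_{\alpha\beta=\gamma}f(\alpha)g(\beta)$. For $f\in\mathbb C\mathscr G$, $\mathrm{supp}(f)=\{\gamma\mid f(\gamma)\neq0\}$. A mean on $\mathscr G^{(0)}$ is a map $\mu\colon\Gamma_c(\mathscr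 G^{(0)})\to[0,\infty)$ with $\mu(U\cup V)=\mu(U)+\mu(V)$ whenever $U\cap V=\emptyset$; it is invariant if $\mu(U^{-1}U)=\mu(UU^{-1})$ for all $U\in\Gamma_c(\mathscr G)$. Each invariant mean extends uniquely to an invariant measure, i.e., a (not necessarily finite) Radon measure $\mu$ on $\mathscr G^{(0)}$ with $\mu(U^{-1}U)=\mu(UU^{-1})$ for all $U\in\Gamma(\mathscr G)$; the extension is also denoted $\mu$. An invariant mean $\mu$ is strongly faithful if (for the extended measure) $\mu(\boldsymbol r(\mathrm{supp}(f)))>0$ for each $0\neq f\in\mathbb C\mathscr G$ (the set $\boldsymbol r(\mathrm{supp}(f))$ is always Borel). *)

theory Defs
  imports "HOL-Analysis.Analysis" "HOL-Algebra.Ring"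
begin

section \<open>Dedekind finite and stably finite rings\<close>

text \<open>
  Rings are not assumed unital. We reuse the ring records of \<open>HOL-Algebra\<close>, but none of the
  following notions looks at the field \<open>one\<close> of the record.
\<close>

definition corner :: "('a, 'm) ring_scheme \<Rightarrow> 'a \<Rightarrow> 'a set" where
  "corner R e = {e \<otimes>\<^bsub>R\<^esub> x \<otimes>\<^bsub>R\<^esub> e |x. x \<in> carrier R}"

definition dedekind_finite :: "('a, 'm) ring_scheme \<Rightarrow> bool" where
  "dedekind_finite R \<longleftrightarrow>
     (\<forall>e\<in>carrier R. e \<otimes>\<^bsub>R\<^esub> e = e \<longrightarrow>
        (\<forall>u\<in>corner R e. \<forall>v\<in>corner R e. u \<otimes>\<^bsub>R\<^esub> v = e \<longrightarrow> v \<otimes>\<^bsub>R\<^esub> u = e))"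

definition matrix_ring :: "nat \<Rightarrow> ('a, 'm) ring_scheme \<Rightarrow> (nat \<times> nat \<Rightarrow> 'a) ring" where
  "matrix_ring n R =
     \<lparr>carrier = {..<n} \<times> {..<n} \<rightarrow>\<^sub>E carrier R,
      mult = (\<lambda>A B. \<lambda>(i, j)\<in>{..<n} \<times> {..<n}. \<Oplus>\<^bsub>R\<^esub>k\<in>{..<n}. A (i, k) \<otimes>\<^bsub>R\<^esub> B (k, j)),
      one = (\<lambda>(i, j)\<in>{..<n} \<times> {..<n}. if i = j then \<one>\<^bsub>R\<^esub> else \<zero>\<^bsub>R\<^esub>),
      zero = (\<lambda>(i, j)\<in>{..<n} \<times> {..<n}. \<zero>\<^bsub>R\<^esub>),
      add = (\<lambda>A B. \<lambda>(i, j)\<in>{..<n} \<times> {..<n}. A (i, j) \<oplus>\<^bsub>R\<^esub> B (i, j))\<rparr>"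

definition stably_finite :: "('a, 'm) ring_scheme \<Rightarrow> bool" where
  "stably_finite R \<longleftrightarrow> (\<forall>n\<ge>1. dedekind_finite (matrix_ring n R))"


section \<open>Ample groupoids\<close>

text \<open>
  A groupoid is given by its set of arrows, the carrier of the topology \<open>gtop\<close>. The operation
  \<open>gcomp\<close> is total in the logic, but only its values on composable pairs of arrows matter.
\<close>

record 'g top_groupoid =
  gtop :: "'g topology"
  gcomp :: "'g \<Rightarrow> 'g \<Rightarrow> 'g"
  ginv :: "'g \<Rightarrow> 'g"

abbreviation arrows :: "'g top_groupoid \<Rightarrow> 'g set" where
  "arrows G \<equiv> topspace (gtop G)"

definition gdom :: "'g top_groupoid \<Rightarrow> 'g \<Rightarrow> 'g" where
  "gdom G \<gamma> = gcomp G (ginv G \<gamma>) \<gamma>"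

definition gran :: "'g top_groupoid \<Rightarrow> 'g \<Rightarrow> 'g" where
  "gran G \<gamma> = gcomp G \<gamma> (ginv G \<gamma>)"

definition composable :: "'g top_groupoid \<Rightarrow> ('g \<times> 'g) set" where
  "composable G = {(\<alpha>, \<beta>). \<alpha> \<in> arrows G \<and> \<beta> \<in> arrows G \<and> gdom G \<alpha> = gran G \<beta>}"

definition units :: "'g top_groupoid \<Rightarrow> 'g set" where
  "units G = gdom G ` arrows G"

definition unit_top :: "'g top_groupoid \<Rightarrow> 'g topology" where
  "unit_top G = subtopology (gtop G) (units G)"

locale groupoid =
  fixes G :: "'g top_groupoid"
  assumes inv_closed: "\<gamma> \<in> arrows G \<Longrightarrow> ginv G \<gamma> \<in> arrows G"
    and dom_inv: "\<gamma> \<in> arrows G \<Longrightarrow> gdom G (ginv G \<gamma>) = gran G \<gamma>"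
    and ran_inv: "\<gamma> \<in> arrows G \<Longrightarrow> gran G (ginv G \<gamma>) = gdom G \<gamma>"
    and comp_closed: "(\<alpha>, \<beta>) \<in> composable G \<Longrightarrow> gcomp G \<alpha> \<beta> \<in> arrows G"
    and dom_comp: "(\<alpha>, \<beta>) \<in> composable G \<Longrightarrow> gdom G (gcomp G \<alpha> \<beta>) = gdom G \<beta>"
    and ran_comp: "(\<alpha>, \<beta>) \<in> composable G \<Longrightarrow> gran G (gcomp G \<alpha> \<beta>) = gran G \<alpha>"
    and comp_assoc: "\<lbrakk>(\<alpha>, \<beta>) \<in> composable G; (\<beta>, \<gamma>) \<in> composable G\<rbrakk>
          \<Longrightarrow> gcomp G (gcomp G \<alpha> \<beta>) \<gamma> = gcomp G \<alpha> (gcomp G \<beta> \<gamma>)"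
    and comp_dom: "\<gamma> \<in> arrows G \<Longrightarrow> gcomp G \<gamma> (gdom G \<gamma>) = \<gamma>"
    and ran_comp_self: "\<gamma> \<in> arrows G \<Longrightarrow> gcomp G (gran G \<gamma>) \<gamma> = \<gamma>"

locale topological_groupoid = groupoid +
  assumes continuous_comp:
      "continuous_map (subtopology (prod_topology (gtop G) (gtop G)) (composable G)) (gtop G)
         (\<lambda>(\<alpha>, \<beta>). gcomp G \<alpha> \<beta>)"
    and continuous_inv: "continuous_map (gtop G) (gtop G) (ginv G)"

definition local_homeomorphism :: "'a topology \<Rightarrow> 'b topology \<Rightarrow> ('a \<Rightarrow> 'b) \<Rightarrow> bool" where
  "local_homeomorphism X Y f \<longleftrightarrow>
     (\<forall>x\<in>topspace X. \<exists>U. openin X U \<and> x \<in> U \<and> openin Y (f ` U) \<and>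
        homeomorphic_map (subtopology X U) (subtopology Y (f ` U)) f)"

locale etale_groupoid = topological_groupoid +
  assumes local_homeomorphism_dom: "local_homeomorphism (gtop G) (unit_top G) (gdom G)"

definition compact_open :: "'a topology \<Rightarrow> 'a set \<Rightarrow> bool" where
  "compact_open X U \<longleftrightarrow> compactin X U \<and> openin X U"

locale ample_groupoid = etale_groupoid +
  assumes Hausdorff_units: "Hausdorff_space (unit_top G)"
    and compact_open_basis:
      "\<lbrakk>openin (unit_top G) U; x \<in> U\<rbrakk> \<Longrightarrow> \<exists>V. compact_open (unit_top G) V \<and> x \<in> V \<and> V \<subseteq> U"

definition open_bisections :: "'g top_groupoid \<Rightarrow> 'g set set" where
  "open_bisections G = {U. openin (gtop G) U \<and> inj_on (gdom G) U \<and> inj_on (gran G) U}"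

definition compact_open_bisections :: "'g top_groupoid \<Rightarrow> 'g set set" where
  "compact_open_bisections G = {U \<in> open_bisections G. compactin (gtop G) U}"

definition compact_open_unit_sets :: "'g top_groupoid \<Rightarrow> 'g set set" where
  "compact_open_unit_sets G = {U. compact_open (unit_top G) U}"

definition set_comp :: "'g top_groupoid \<Rightarrow> 'g set \<Rightarrow> 'g set \<Rightarrow> 'g set" where
  "set_comp G U V = {gcomp G \<alpha> \<beta> |\<alpha> \<beta>. \<alpha> \<in> U \<and> \<beta> \<in> V \<and> (\<alpha>, \<beta>) \<in> composable G}"

definition set_inv :: "'g top_groupoid \<Rightarrow> 'g set \<Rightarrow> 'g set" where
  "set_inv G U = ginv G ` U"


section \<open>Groupoid algebras\<close>

text \<open>
  Functions on the groupoid are extended by zero to the whole type of arrows. In the convolution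
  product, vanishing terms are left out of the sum: for elements of the groupoid algebra only
  finitely many terms remain, while HOL assigns the value 0 to a sum over an infinite index set.
\<close>

definition convolution ::
    "'g top_groupoid \<Rightarrow> ('g \<Rightarrow> 'k::comm_ring_1) \<Rightarrow> ('g \<Rightarrow> 'k) \<Rightarrow> 'g \<Rightarrow> 'k" where
  "convolution G f g \<gamma> =
     (\<Sum>(\<alpha>, \<beta>) \<in> {(\<alpha>, \<beta>) \<in> composable G. gcomp G \<alpha> \<beta> = \<gamma> \<and> f \<alpha> * g \<beta> \<noteq> 0}. f \<alpha> * g \<beta>)"

text \<open>
  The field \<open>one\<close> is the indicator function of the unit space, which lies in the carrier only
  when the unit space is compact; otherwise the algebra has no identity.
\<close>

definition groupoid_algebra :: "'g top_groupoid \<Rightarrow> ('g \<Rightarrow> 'k::comm_ring_1) ring" where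
  "groupoid_algebra G =
     \<lparr>carrier = {\<lambda>\<gamma>. \<Sum>U\<in>F. c U * indicator U \<gamma> |F c.
                   finite F \<and> F \<subseteq> compact_open_bisections G},
      mult = convolution G,
      one = indicator (units G),
      zero = (\<lambda>\<gamma>. 0),
      add = (\<lambda>f g \<gamma>. f \<gamma> + g \<gamma>)\<rparr>"

definition supp :: "('g \<Rightarrow> 'k::zero) \<Rightarrow> 'g set" where
  "supp f = {\<gamma>. f \<gamma> \<noteq> 0}"


section \<open>Invariant means and measures\<close>

text \<open>Only the values of \<open>\<mu>\<close> on the compact open subsets of the unit space matter.\<close>

definition mean :: "'g top_groupoid \<Rightarrow> ('g set \<Rightarrow> real) \<Rightarrow> bool" where
  "mean G \<mu> \<longleftrightarrow>
     (\<forall>U\<in>compact_open_unit_sets G. \<mu> U \<ge> 0) \<and>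
     (\<forall>U\<in>compact_open_unit_sets G. \<forall>V\<in>compact_open_unit_sets G.
        U \<inter> V = {} \<longrightarrow> \<mu> (U \<union> V) = \<mu> U + \<mu> V)"

definition invariant_mean :: "'g top_groupoid \<Rightarrow> ('g set \<Rightarrow> real) \<Rightarrow> bool" where
  "invariant_mean G \<mu> \<longleftrightarrow> mean G \<mu> \<and>
     (\<forall>U\<in>compact_open_bisections G.
        \<mu> (set_comp G (set_inv G U) U) = \<mu> (set_comp G U (set_inv G U)))"

text \<open>
  Radon measures in the sense of the Riesz representation theorem on locally compact Hausdorff
  spaces: outer regular on Borel sets, inner regular on open sets, finite on compact sets.
\<close>

definition radon_measure :: "'a topology \<Rightarrow> 'a measure \<Rightarrow> bool" where
  "radon_measure X M \<longleftrightarrow>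
     space M = topspace X \<and>
     sets M = sigma_sets (topspace X) {U. openin X U} \<and>
     (\<forall>C. compactin X C \<longrightarrow> emeasure M C < \<infinity>) \<and>
     (\<forall>A\<in>sets M. emeasure M A = (INF U\<in>{U. openin X U \<and> A \<subseteq> U}. emeasure M U)) \<and>
     (\<forall>U. openin X U \<longrightarrow> emeasure M U = (SUP C\<in>{C. compactin X C \<and> C \<subseteq> U}. emeasure M C))"

definition invariant_measure :: "'g top_groupoid \<Rightarrow> 'g measure \<Rightarrow> bool" where
  "invariant_measure G M \<longleftrightarrow> radon_measure (unit_top G) M \<and>
     (\<forall>U\<in>open_bisections G.
        emeasure M (set_comp G (set_inv G U) U) = emeasure M (set_comp G U (set_inv G U)))"

definition extends_mean :: "'g top_groupoid \<Rightarrow> 'g measure \<Rightarrow> ('g set \<Rightarrow> real) \<Rightarrow> bool" where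
  "extends_mean G M \<mu> \<longleftrightarrow> (\<forall>U\<in>compact_open_unit_sets G. emeasure M U = ennreal (\<mu> U))"

text \<open>
  Over an ample groupoid, an invariant mean has exactly one extension to an invariant measure,
  so the existential quantifier refers to the extended measure.
\<close>

definition strongly_faithful :: "'g top_groupoid \<Rightarrow> ('g set \<Rightarrow> real) \<Rightarrow> bool" where
  "strongly_faithful G \<mu> \<longleftrightarrow>
     (\<exists>M. invariant_measure G M \<and> extends_mean G M \<mu> \<and>
        (\<forall>f \<in> carrier (groupoid_algebra G :: ('g \<Rightarrow> complex) ring).
           f \<noteq> (\<lambda>\<gamma>. 0) \<longrightarrow> emeasure M (gran G ` supp f) > 0))"

end

theory Submission
  imports Defs "HOL-Library.Function_Algebras" "HOL-Computational_Algebra.Fundamental_Theorem_Algebra"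
begin

text \<open>
  The finitely many coefficients of a hypothetical counterexample over \<open>K\<close> generate a countable subring,
  which embeds into \<open>\<complex>\<close>; so one may take \<open>K = \<complex>\<close>. Integration over the unit space against the invariant
  measure is a trace on \<open>\<complex>\<G>\<close>: the trace of \<open>f f\<^sup>*\<close> is the integral of \<open>x \<mapsto> \<Sum>\<bar>f \<gamma>\<bar>\<^sup>2\<close> (sum over
  \<open>\<gamma>\<close> with range \<open>x\<close>), which vanishes only if the range of the support of \<open>f\<close> is a null set, that is, by
  strong faithfulness, only if \<open>f = 0\<close>. The trace extends to matrices. If \<open>u v = e\<close> in a corner, then
  \<open>e - v u\<close> is an idempotent of trace zero, and such an idempotent vanishes by an approximate form of
  Kaplansky's argument that takes place inside the algebra, without passing to a completion.
\<close>

section \<open>Idempotents in algebras with a faithful trace\<close>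

text \<open>The algebra has no unit and is not complete, and the unit space may have infinite
  measure. Hence 1 + w, its inverse and 1 - p are available only through their products with
  elements of the algebra, and the trace is not continuous for the trace norm; it is controlled only
  on products, by Cauchy-Schwarz. The single analytic input is that right multiplication by a fixed
  element is bounded for the trace norm. It holds because the algebra is spanned by the functions c
  \<open>1_U\<close>, which are scalar multiples of partial isometries.

  The groupoid need not be Hausdorff, so the intersection of two compact open bisections, or of one
  with the unit space, can fail to be compact. The mean does not see such sets. This is why the
  trace is an integral against the extended measure, and why invariance on all open bisections
  matters.

  The passage to \<complex> uses a relation between two subrings that grows by one element at a
  time, so that neither a fraction field nor an algebraic closure has to be built as a type.\<close>

instantiation "fun" :: (type, real_vector) real_vector
begin

definition "scaleR r f = (\<lambda>x. r *\<^sub>R f x)"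

instance
  by standard (auto simp: scaleR_fun_def fun_eq_iff algebra_simps)

end

lemma scaleR_fun_apply [simp]: "(r *\<^sub>R f) x = r *\<^sub>R f x"
  by (simp add: scaleR_fun_def)

lemma sum_fun_eq: "sum f I = (\<lambda>x. \<Sum>i\<in>I. f i x)"
  by (induction I rule: infinite_finite_induct) (simp_all add: fun_eq_iff)

text \<open>Real scalars and a real-valued trace suffice, since all that is wanted is a symmetric
  positive definite form \<open>tr (a \<odot> b\<^sup>\<star>)\<close>. For complex functions it is
  the real part of the usual one.\<close>

locale tracial_star_algebra =
  fixes A :: "'a::real_vector set"
    and mul :: "'a \<Rightarrow> 'a \<Rightarrow> 'a" (infixl "\<odot>" 70)
    and star :: "'a \<Rightarrow> 'a" ("_\<^sup>\<star>" [1000] 999)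
    and tr :: "'a \<Rightarrow> real"
  assumes subspace: "subspace A"
    and mul_closed: "\<lbrakk>a \<in> A; b \<in> A\<rbrakk> \<Longrightarrow> a \<odot> b \<in> A"
    and mul_add_left: "\<lbrakk>a \<in> A; b \<in> A; c \<in> A\<rbrakk> \<Longrightarrow> (a + b) \<odot> c = a \<odot> c + b \<odot> c"
    and mul_add_right: "\<lbrakk>a \<in> A; b \<in> A; c \<in> A\<rbrakk> \<Longrightarrow> a \<odot> (b + c) = a \<odot> b + a \<odot> c"
    and mul_scaleR_left: "\<lbrakk>a \<in> A; b \<in> A\<rbrakk> \<Longrightarrow> (r *\<^sub>R a) \<odot> b = r *\<^sub>R (a \<odot> b)"
    and mul_scaleR_right: "\<lbrakk>a \<in> A; b \<in> A\<rbrakk> \<Longrightarrow> a \<odot> (r *\<^sub>R b) = r *\<^sub>R (a \<odot> b)"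
    and mul_assoc: "\<lbrakk>a \<in> A; b \<in> A; c \<in> A\<rbrakk> \<Longrightarrow> (a \<odot> b) \<odot> c = a \<odot> (b \<odot> c)"
    and star_closed: "a \<in> A \<Longrightarrow> a\<^sup>\<star> \<in> A"
    and star_add: "\<lbrakk>a \<in> A; b \<in> A\<rbrakk> \<Longrightarrow> (a + b)\<^sup>\<star> = a\<^sup>\<star> + b\<^sup>\<star>"
    and star_scaleR: "a \<in> A \<Longrightarrow> (r *\<^sub>R a)\<^sup>\<star> = r *\<^sub>R a\<^sup>\<star>"
    and star_star: "a \<in> A \<Longrightarrow> (a\<^sup>\<star>)\<^sup>\<star> = a"
    and star_mul: "\<lbrakk>a \<in> A; b \<in> A\<rbrakk> \<Longrightarrow> (a \<odot> b)\<^sup>\<star> = b\<^sup>\<star> \<odot> a\<^sup>\<star>"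
    and tr_add: "\<lbrakk>a \<in> A; b \<in> A\<rbrakk> \<Longrightarrow> tr (a + b) = tr a + tr b"
    and tr_scaleR: "a \<in> A \<Longrightarrow> tr (r *\<^sub>R a) = r * tr a"
    and tr_mul_commute: "\<lbrakk>a \<in> A; b \<in> A\<rbrakk> \<Longrightarrow> tr (a \<odot> b) = tr (b \<odot> a)"
    and tr_star: "a \<in> A \<Longrightarrow> tr (a\<^sup>\<star>) = tr a"
    and tr_nonneg: "a \<in> A \<Longrightarrow> tr (a \<odot> a\<^sup>\<star>) \<ge> 0"
    and tr_faithful: "\<lbrakk>a \<in> A; tr (a \<odot> a\<^sup>\<star>) = 0\<rbrakk> \<Longrightarrow> a = 0"
begin

lemma zero_closed: "0 \<in> A"
  and add_closed: "\<lbrakk>a \<in> A; b \<in> A\<rbrakk> \<Longrightarrow> a + b \<in> A"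
  and diff_closed: "\<lbrakk>a \<in> A; b \<in> A\<rbrakk> \<Longrightarrow> a - b \<in> A"
  and scaleR_closed: "a \<in> A \<Longrightarrow> r *\<^sub>R a \<in> A"
  using subspace by (auto simp: subspace_0 subspace_add subspace_diff subspace_scale)

lemmas closed = zero_closed add_closed diff_closed scaleR_closed mul_closed star_closed

lemma mul_diff_left:
  assumes "a \<in> A" "b \<in> A" "c \<in> A" shows "(a - b) \<odot> c = a \<odot> c - b \<odot> c"
  using mul_add_left[of "a - b" b c] assms by (simp add: closed)

lemma mul_diff_right:
  assumes "a \<in> A" "b \<in> A" "c \<in> A" shows "a \<odot> (b - c) = a \<odot> b - a \<odot> c"
  using mul_add_right[of a "b - c" c] assms by (simp add: closed)

lemma star_diff:
  assumes "a \<in> A" "b \<in> A" shows "(a - b)\<^sup>\<star> = a\<^sup>\<star> - b\<^sup>\<star>"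
  using star_add[of "a - b" b] assms by (simp add: closed)

lemma tr_diff:
  assumes "a \<in> A" "b \<in> A" shows "tr (a - b) = tr a - tr b"
  using tr_add[of "a - b" b] assms by (simp add: closed)

lemma tr_0: "tr 0 = 0"
  using tr_diff[of 0 0] by (simp add: closed)

lemma mul_0_left: "a \<in> A \<Longrightarrow> 0 \<odot> a = 0"
  using mul_diff_left[of 0 0 a] by (simp add: closed)

lemma mul_0_right: "a \<in> A \<Longrightarrow> a \<odot> 0 = 0"
  using mul_diff_right[of a 0 0] by (simp add: closed)

lemma star_0: "0\<^sup>\<star> = 0"
  using star_diff[of 0 0] by (simp add: closed)

lemmas expand = mul_add_left mul_add_right mul_diff_left mul_diff_right mul_scaleR_left
  mul_scaleR_right star_add star_diff star_scaleR star_mul star_star tr_add tr_diff tr_scaleR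

text \<open>The square of the trace 2-norm. Working with squares avoids roots, and the triangle
  inequality becomes the parallelogram estimate with factor 2.\<close>

definition nrm :: "'a \<Rightarrow> real" where
  "nrm a = tr (a \<odot> a\<^sup>\<star>)"

lemma nrm_nonneg: "a \<in> A \<Longrightarrow> nrm a \<ge> 0"
  by (simp add: nrm_def tr_nonneg)

lemma nrm_star: "a \<in> A \<Longrightarrow> nrm (a\<^sup>\<star>) = nrm a"
  by (simp add: nrm_def star_star star_closed tr_mul_commute)

lemma nrm_scaleR: "a \<in> A \<Longrightarrow> nrm (r *\<^sub>R a) = r\<^sup>2 * nrm a"
  by (simp add: nrm_def expand closed power2_eq_square)

lemma tr_mul_star_commute:
  assumes "a \<in> A" "b \<in> A" shows "tr (a \<odot> b\<^sup>\<star>) = tr (b \<odot> a\<^sup>\<star>)"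
  using tr_star[of "b \<odot> a\<^sup>\<star>"] assms by (simp add: closed expand)

lemma nrm_add:
  assumes "a \<in> A" "b \<in> A"
  shows "nrm (a + b) = nrm a + 2 * tr (a \<odot> b\<^sup>\<star>) + nrm b"
  using assms tr_mul_star_commute[of a b] by (simp add: nrm_def expand closed)

lemma nrm_diff:
  assumes "a \<in> A" "b \<in> A"
  shows "nrm (a - b) = nrm a - 2 * tr (a \<odot> b\<^sup>\<star>) + nrm b"
  using assms tr_mul_star_commute[of a b] by (simp add: nrm_def expand closed)

lemma nrm_add_le:
  assumes "a \<in> A" "b \<in> A" shows "nrm (a + b) \<le> 2 * nrm a + 2 * nrm b"
  using nrm_nonneg[of "a - b"] assms by (simp add: nrm_add nrm_diff closed)

text \<open>Cauchy-Schwarz in Young's form: expand the nonnegative \<open>nrm\<close> of the sum and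
  of the difference of \<open>s *\<^sub>R a\<close> and
  \<open>(1/s) *\<^sub>R b\<^sup>\<star>\<close>. The free weight d later allows one term to be
  absorbed.\<close>

lemma abs_tr_mul_le:
  assumes "a \<in> A" "b \<in> A" "d > 0"
  shows "2 * \<bar>tr (a \<odot> b)\<bar> \<le> d * nrm a + nrm b / d"
proof -
  define s where "s = sqrt d"
  have s: "s > 0" "s\<^sup>2 = d" using assms by (auto simp: s_def)
  have eq: "tr ((s *\<^sub>R a) \<odot> ((1/s) *\<^sub>R b\<^sup>\<star>)\<^sup>\<star>) = tr (a \<odot> b)"
    using assms s by (simp add: closed expand)
  have n: "nrm (s *\<^sub>R a) = d * nrm a" "nrm ((1/s) *\<^sub>R b\<^sup>\<star>) = nrm b / d"
    using assms s by (simp_all add: nrm_scaleR nrm_star closed power_divide)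
  show ?thesis
    using nrm_nonneg[of "s *\<^sub>R a + (1/s) *\<^sub>R b\<^sup>\<star>"] nrm_nonneg[of "s *\<^sub>R a - (1/s) *\<^sub>R b\<^sup>\<star>"]
      assms eq n by (simp add: nrm_add nrm_diff closed)
qed

lemma nrm_mul_add_le:
  assumes "a \<in> A" "b \<in> A" "x \<in> A" "nrm (x \<odot> a) \<le> B * nrm x" "nrm (x \<odot> b) \<le> C * nrm x"
  shows "nrm (x \<odot> (a + b)) \<le> (2 * B + 2 * C) * nrm x"
  using nrm_add_le[of "x \<odot> a" "x \<odot> b"] assms by (simp add: closed mul_add_right algebra_simps)

text \<open>For r > 0 such an a is a multiple of a partial isometry with range projection p.
  Positivity at x p and at x - x p, the substitute for x (1 - p), puts the trace of x p
  \<open>x\<^sup>\<star>\<close> between 0 and \<open>nrm x\<close>.\<close>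

lemma nrm_mul_partial_isometry_le:
  assumes a: "a \<in> A" "a \<odot> a\<^sup>\<star> = r *\<^sub>R p" and p: "p \<in> A" "p \<odot> p = p" "p\<^sup>\<star> = p" and x: "x \<in> A"
  shows "nrm (x \<odot> a) \<le> \<bar>r\<bar> * nrm x"
proof -
  have pp: "p \<odot> (p \<odot> y) = p \<odot> y" if "y \<in> A" for y
    using that p by (simp flip: mul_assoc)
  have "nrm (x \<odot> a) = tr (x \<odot> ((a \<odot> a\<^sup>\<star>) \<odot> x\<^sup>\<star>))"
    using a(1) x by (simp add: nrm_def star_mul mul_assoc closed)
  also have "\<dots> = r * tr (x \<odot> (p \<odot> x\<^sup>\<star>))"
    using p x by (simp add: a(2) expand closed)
  finally have xa: "nrm (x \<odot> a) = r * tr (x \<odot> (p \<odot> x\<^sup>\<star>))" .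
  have "nrm (x \<odot> p) = tr (x \<odot> (p \<odot> x\<^sup>\<star>))" "nrm (x - x \<odot> p) = nrm x - tr (x \<odot> (p \<odot> x\<^sup>\<star>))"
    using p x by (simp_all add: nrm_def expand closed mul_assoc pp)
  then have "0 \<le> tr (x \<odot> (p \<odot> x\<^sup>\<star>))" "tr (x \<odot> (p \<odot> x\<^sup>\<star>)) \<le> nrm x"
    using nrm_nonneg[of "x \<odot> p"] nrm_nonneg[of "x - x \<odot> p"] p x by (simp_all add: closed)
  then show ?thesis
    unfolding xa by (intro mult_mono) auto
qed

end

text \<open>The bound stands in for an operator norm: it limits the spectrum of the element to be
  inverted, and it carries smallness of p over to p f.\<close>

locale bounded_tracial_star_algebra = tracial_star_algebra +
  assumes right_mul_bounded: "a \<in> A \<Longrightarrow> \<exists>B. \<forall>x\<in>A. nrm (x \<odot> a) \<le> B * nrm x"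
begin

lemma right_mul_boundedE:
  assumes "a \<in> A"
  obtains B where "B \<ge> 1" "\<And>x. x \<in> A \<Longrightarrow> nrm (x \<odot> a) \<le> B * nrm x"
proof -
  obtain B where B: "\<And>x. x \<in> A \<Longrightarrow> nrm (x \<odot> a) \<le> B * nrm x"
    using right_mul_bounded[OF assms] by auto
  have "nrm (x \<odot> a) \<le> max 1 B * nrm x" if "x \<in> A" for x
    using B[OF that] mult_right_mono[OF max.cobounded2[of B 1] nrm_nonneg[OF that]] by linarith
  then show thesis using that[of "max 1 B"] by simp
qed

text \<open>
  For an idempotent \<open>f\<close>, put \<open>z = 1 + (f - f\<^sup>\<star>)(f - f\<^sup>\<star>)\<^sup>\<star>\<close>. In Kaplansky's argument \<open>z\<close> commutes with
  \<open>f\<close> and \<open>f f\<^sup>\<star> z\<^sup>-\<^sup>1\<close> is a projection with the same range as \<open>f\<close>. The element \<open>p\<close> obtained here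
  is \<open>f f\<^sup>\<star>\<close> times a partial sum of the Neumann series of \<open>z\<^sup>-\<^sup>1\<close>, so that \<open>z\<close> need not be
  inverted, and \<open>x\<close> is the error term.
\<close>

lemma approximate_range_projection:
  assumes f: "f \<in> A" "f \<odot> f = f" and "\<epsilon> > 0"
  obtains p x where "p \<in> A" "x \<in> A" "p\<^sup>\<star> = p" "f \<odot> p = p" "f \<odot> x = x" "p \<odot> f = f - x" "nrm x < \<epsilon>"
proof -
  define h where "h = f - f\<^sup>\<star>"
  define w where "w = f \<odot> f\<^sup>\<star> + f\<^sup>\<star> \<odot> f - f - f\<^sup>\<star>"
  note cl = closed f(1)
  have hA [simp]: "h \<in> A" and wA [simp]: "w \<in> A" by (auto simp: h_def w_def intro!: cl)
  have ff [simp]: "f\<^sup>\<star> \<odot> f\<^sup>\<star> = f\<^sup>\<star>"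
    using star_mul[of f f] f by simp
  have ff3: "f \<odot> (f \<odot> a) = f \<odot> a" "f\<^sup>\<star> \<odot> (f\<^sup>\<star> \<odot> a) = f\<^sup>\<star> \<odot> a" if "a \<in> A" for a
    using that f ff by (simp_all add: mul_assoc[symmetric] cl)
  have w_star: "w\<^sup>\<star> = w" by (simp add: w_def expand cl)
  have hh: "h \<odot> h\<^sup>\<star> = w" 
    by (simp add: h_def w_def expand cl f(2))
  \<comment> \<open>With z = 1 + w the second equation reads
    \<open>f f\<^sup>\<star> f = f z\<close>; it is the reason why
    \<open>f f\<^sup>\<star> z\<^sup>-\<^sup>1\<close> fixes f.\<close>
  have fw: "f \<odot> w = w \<odot> f" "f \<odot> (f\<^sup>\<star> \<odot> f) = f + f \<odot> w"
    by (simp_all add: w_def expand cl f(2) mul_assoc ff3)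
  have fsw: "f\<^sup>\<star> \<odot> w = w \<odot> f\<^sup>\<star>"
    by (simp add: w_def expand cl f(2) mul_assoc ff3)
  obtain B where B: "B \<ge> 1" "\<And>x. x \<in> A \<Longrightarrow> nrm (x \<odot> h\<^sup>\<star>) \<le> B * nrm x"
    by (rule right_mul_boundedE[OF star_closed[OF hA]]) blast
  \<comment> \<open>The bound B places the spectrum of z = 1 + w in [1, 1 + B]. For this c, the
    values of 1 - c z lie between -(1 - c) and 1 - c, the optimal rate for an iteration with a fixed
    step.\<close>
  define c where "c = 2 / (B + 2)"
  have c: "c > 0" "c < 1" "c * B = 2 * (1 - c)"
    using B(1) by (auto simp: c_def field_simps)
  \<comment> \<open>Loop invariant of the Neumann series. The symmetry
    \<open>x f\<^sup>\<star> = f x\<^sup>\<star>\<close> keeps p self-adjoint, and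
    \<open>x f\<^sup>\<star> f = x z\<close> makes \<open>p f = f - x\<close> telescope when c
    \<open>x f\<^sup>\<star>\<close> is added to p.\<close>
  define Q where "Q x p \<longleftrightarrow> x \<in> A \<and> p \<in> A \<and> f \<odot> x = x \<and> w \<odot> x = x \<odot> w \<and>
      x \<odot> f\<^sup>\<star> = f \<odot> x\<^sup>\<star> \<and> x \<odot> (f\<^sup>\<star> \<odot> f) = x + x \<odot> w \<and>
      p\<^sup>\<star> = p \<and> f \<odot> p = p \<and> p \<odot> f = f - x" for x p
  \<comment> \<open>This is x (1 - c z), written without the unit.\<close>
  define X where "X = (\<lambda>x. (1 - c) *\<^sub>R x - c *\<^sub>R (x \<odot> w))"
  have step: "Q (X x) (p + c *\<^sub>R (x \<odot> f\<^sup>\<star>))" if "Q x p" for x p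
  proof -
    from that have q: "x \<in> A" "p \<in> A" "f \<odot> x = x" "w \<odot> x = x \<odot> w"
      "x \<odot> f\<^sup>\<star> = f \<odot> x\<^sup>\<star>" "x \<odot> (f\<^sup>\<star> \<odot> f) = x + x \<odot> w"
      "p\<^sup>\<star> = p" "f \<odot> p = p" "p \<odot> f = f - x" by (auto simp: Q_def)
    note cl = cl q(1,2)
    have s: "w \<odot> x\<^sup>\<star> = x\<^sup>\<star> \<odot> w"
      using arg_cong[OF q(4), of star] by (simp add: expand cl w_star)
    have ws: "w \<odot> x\<^sup>\<star> \<in> A" by (intro cl wA)
    have a1: "f \<odot> (x \<odot> w) = x \<odot> w"
      by (subst mul_assoc[symmetric]) (simp_all add: q cl)
    have a2: "w \<odot> (x \<odot> w) = (x \<odot> w) \<odot> w"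
      by (subst mul_assoc[symmetric]) (simp_all add: q cl)
    have a3: "(x \<odot> w) \<odot> f\<^sup>\<star> = f \<odot> (w \<odot> x\<^sup>\<star>)"
    proof -
      have "(x \<odot> w) \<odot> f\<^sup>\<star> = (x \<odot> f\<^sup>\<star>) \<odot> w" by (simp add: mul_assoc cl fsw)
      also have "\<dots> = f \<odot> (w \<odot> x\<^sup>\<star>)" by (simp add: mul_assoc cl q(5) s)
      finally show ?thesis .
    qed
    have a4: "(x \<odot> w) \<odot> (f\<^sup>\<star> \<odot> f) = x \<odot> w + (x \<odot> w) \<odot> w"
    proof -
      have "w \<odot> (f\<^sup>\<star> \<odot> f) = (f\<^sup>\<star> \<odot> f) \<odot> w"
        by (simp add: mul_assoc[symmetric] cl flip: fsw) (simp add: mul_assoc cl fw)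
      then have "(x \<odot> w) \<odot> (f\<^sup>\<star> \<odot> f) = (x \<odot> (f\<^sup>\<star> \<odot> f)) \<odot> w"
        by (simp add: mul_assoc cl)
      then show ?thesis by (simp add: q expand cl)
    qed
    have a5: "f \<odot> (x \<odot> f\<^sup>\<star>) = x \<odot> f\<^sup>\<star>"
      by (subst mul_assoc[symmetric]) (simp_all add: q cl)
    show ?thesis unfolding Q_def X_def
    proof (intro conjI)
      show "(1 - c) *\<^sub>R x - c *\<^sub>R (x \<odot> w) \<in> A" "p + c *\<^sub>R (x \<odot> f\<^sup>\<star>) \<in> A"
        by (intro cl wA)+
    qed (simp_all add: expand cl q(3,4,7,8,9) a1 a2 a3 a4 a5 q(6) w_star mul_assoc[of x "f\<^sup>\<star>" f] algebra_simps, simp_all add: q(5) s)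
  qed
  have contract: "nrm (X x) \<le> (1 - c)\<^sup>2 * nrm x" if x: "x \<in> A" for x
  proof -
    have t: "tr (x \<odot> (x \<odot> w)\<^sup>\<star>) = nrm (x \<odot> h)"
      by (simp add: nrm_def expand cl x w_star flip: hh) (simp add: mul_assoc expand cl x)
    \<comment> \<open>As x w = (x h) \<open>h\<^sup>\<star>\<close>, the bound is applied to x h
      rather than twice to x. Then c B = 2 (1 - c) bounds the quadratic term by exactly the amount
      that the mixed term subtracts.\<close>
    have "nrm (x \<odot> w) \<le> B * nrm (x \<odot> h)"
      using B(2)[of "x \<odot> h"] x by (simp add: mul_assoc cl hh)
    then have "c\<^sup>2 * nrm (x \<odot> w) \<le> c * (c * B) * nrm (x \<odot> h)"
      using mult_left_mono[of _ _ "c\<^sup>2"] by (fastforce simp: power2_eq_square mult.assoc)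
    moreover have "nrm (X x) = (1 - c)\<^sup>2 * nrm x - 2 * (c * (1 - c)) * nrm (x \<odot> h) + c\<^sup>2 * nrm (x \<odot> w)"
      using x t unfolding X_def
      by (subst nrm_diff) (simp_all add: nrm_scaleR cl expand)
    ultimately show ?thesis unfolding c(3) by (simp add: mult.assoc mult.left_commute)
  qed
  have iter: "\<exists>p. Q ((X ^^ n) f) p \<and> nrm ((X ^^ n) f) \<le> ((1 - c)\<^sup>2) ^ n * nrm f" for n
  proof (induction n)
    case 0
    have "Q f 0"
      using fw by (auto simp: Q_def cl f(2) star_0 mul_0_left mul_0_right)
    then show ?case by auto
  next
    case (Suc n)
    then obtain p where p: "Q ((X ^^ n) f) p" "nrm ((X ^^ n) f) \<le> ((1 - c)\<^sup>2) ^ n * nrm f" by blast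
    have "nrm (X ((X ^^ n) f)) \<le> (1 - c)\<^sup>2 * nrm ((X ^^ n) f)"
      using contract p(1) by (auto simp: Q_def)
    also have "\<dots> \<le> (1 - c)\<^sup>2 * (((1 - c)\<^sup>2) ^ n * nrm f)"
      by (intro mult_left_mono p) auto
    finally show ?case
      using step[OF p(1)] by (auto simp: mult.assoc)
  qed
  have "(\<lambda>n. ((1 - c)\<^sup>2) ^ n * nrm f) \<longlonglongrightarrow> 0 * nrm f"
    using c by (intro tendsto_intros LIMSEQ_realpow_zero) (auto simp: power_less_one_iff)
  then have "eventually (\<lambda>n. ((1 - c)\<^sup>2) ^ n * nrm f < \<epsilon>) sequentially"
    using \<open>\<epsilon> > 0\<close> by (intro order_tendstoD(2)) auto
  then obtain n where "((1 - c)\<^sup>2) ^ n * nrm f < \<epsilon>"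
    using eventually_happens'[OF sequentially_bot] by blast
  then obtain p where "Q ((X ^^ n) f) p" "nrm ((X ^^ n) f) < \<epsilon>"
    using iter[of n] by force
  then show thesis using that by (auto simp: Q_def)
qed

text \<open>The approximate range projection has tr p = - tr x and p p = p - x p, so
  \<open>nrm p\<close> is made of traces that contain the error x. Then f = p f + x is small as
  well.\<close>

theorem idempotent_eq_0:
  assumes f: "f \<in> A" "f \<odot> f = f" and "tr f = 0"
  shows "f = 0"
proof -
  obtain K where K: "K \<ge> 1" "\<And>x. x \<in> A \<Longrightarrow> nrm (x \<odot> f) \<le> K * nrm x"
    using right_mul_boundedE[OF f(1)] by blast
  \<comment> \<open>Chosen so that the contribution 2 K d \<open>nrm f\<close> below is half of
    \<open>nrm f\<close> and can be moved to the left; L is the total factor in front of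
    \<open>nrm x\<close>.\<close>
  define d where "d = 1 / (4 * K)"
  have d: "d > 0" "K * d = 1 / 4" using K by (auto simp: d_def)
  define L where "L = 2 * K * (1 / d + 1) + 2"
  have L: "L > 0" using K(1) d(1) by (auto simp: L_def intro!: add_nonneg_pos)
  have "nrm f \<le> 0 + e" if "e > 0" for e
  proof -
    from that L have "e / (2 * L) > 0" by simp
    then obtain p x where px: "p \<in> A" "x \<in> A" "p\<^sup>\<star> = p" "f \<odot> p = p" "f \<odot> x = x" "p \<odot> f = f - x"
      "nrm x < e / (2 * L)"
      using approximate_range_projection[OF f] by blast
    note cl = closed f(1) px(1,2)
    have "p \<odot> p = (p \<odot> f) \<odot> p" using px(4) by (simp add: mul_assoc cl)
    also have "\<dots> = p - x \<odot> p" by (simp add: px expand cl)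
    finally have "nrm p = tr p - tr (x \<odot> p)" by (simp add: nrm_def px expand cl)
    moreover have "tr p = - tr x"
      using tr_mul_commute[of f p] px \<open>tr f = 0\<close> by (simp add: expand cl)
    \<comment> \<open>Without a unit, tr x alone is not bounded by \<open>nrm x\<close>; as a
      product with f it falls under Cauchy-Schwarz.\<close>
    moreover have "tr x = tr (f \<odot> x)" by (simp add: px)
    ultimately have "2 * nrm p \<le> 2 * \<bar>tr (f \<odot> x)\<bar> + 2 * \<bar>tr (x \<odot> p)\<bar>" by linarith
    \<comment> \<open>Weight d keeps the share of \<open>nrm f\<close> small; weight 1 leaves a
      single \<open>nrm p\<close>, which cancels against the two on the left.\<close>
    also have "\<dots> \<le> (d * nrm f + nrm x / d) + (1 * nrm x + nrm p / 1)"
      using abs_tr_mul_le[of f x d] abs_tr_mul_le[of x p 1] d by (intro add_mono) (auto intro: cl)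
    finally have p: "nrm p \<le> d * nrm f + (1 / d + 1) * nrm x" by (simp add: algebra_simps)
    have "nrm f = nrm (p \<odot> f + x)" by (simp add: px)
    also have "\<dots> \<le> 2 * nrm (p \<odot> f) + 2 * nrm x" by (intro nrm_add_le cl)
    also have "\<dots> \<le> 2 * (K * nrm p) + 2 * nrm x" using K(2)[OF px(1)] by linarith
    also have "\<dots> \<le> 2 * (K * (d * nrm f + (1 / d + 1) * nrm x)) + 2 * nrm x"
      using K p by (intro add_mono mult_left_mono) auto
    also have "\<dots> = 2 * (K * d) * nrm f + L * nrm x"
      by (simp add: L_def algebra_simps)
    also have "\<dots> = nrm f / 2 + L * nrm x" by (simp add: d)
    finally have "nrm f \<le> 2 * L * nrm x" by simp
    also have "\<dots> \<le> e"
      using px(7) L by (simp add: field_simps)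
    finally show ?thesis by simp
  qed
  then have "nrm f \<le> 0" by (rule field_le_epsilon)
  then show ?thesis using tr_faithful[of f] nrm_nonneg[of f] f by (auto simp: nrm_def)
qed

theorem left_inverse_eq_right_inverse:
  assumes A: "e \<in> A" "u \<in> A" "v \<in> A" and e: "e \<odot> e = e" "e \<odot> u = u" "u \<odot> e = u" "e \<odot> v = v" "v \<odot> e = v"
    and uv: "u \<odot> v = e"
  shows "v \<odot> u = e"
proof -
  have "(v \<odot> u) \<odot> (v \<odot> u) = v \<odot> ((u \<odot> v) \<odot> u)"
    using A by (simp add: mul_assoc closed)
  then have vu: "(v \<odot> u) \<odot> (v \<odot> u) = v \<odot> u"
    using uv e by simp
  have "e \<odot> (v \<odot> u) = v \<odot> u" "(v \<odot> u) \<odot> e = v \<odot> u"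
    using A e mul_assoc[of e v u] by (simp_all add: mul_assoc)
  then have "(e - v \<odot> u) \<odot> (e - v \<odot> u) = e - v \<odot> u"
    using A e vu by (simp add: mul_diff_left mul_diff_right closed)
  moreover have "tr (e - v \<odot> u) = 0"
    using A uv tr_mul_commute[of u v] by (simp add: tr_diff closed)
  ultimately have "e - v \<odot> u = 0"
    using A by (intro idempotent_eq_0 closed) auto
  then show ?thesis by simp
qed

subsection \<open>Matrices\<close>

lemma sum_closed: "(\<And>i. i \<in> I \<Longrightarrow> f i \<in> A) \<Longrightarrow> sum f I \<in> A"
  using subspace by (rule subspace_sum)

lemma mul_sum_left:
  assumes "\<And>i. i \<in> I \<Longrightarrow> f i \<in> A" "a \<in> A"
  shows "sum f I \<odot> a = (\<Sum>i\<in>I. f i \<odot> a)"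
  using assms
  by (induction I rule: infinite_finite_induct) (auto simp: mul_0_left mul_add_left sum_closed)

lemma mul_sum_right:
  assumes "\<And>i. i \<in> I \<Longrightarrow> f i \<in> A" "a \<in> A"
  shows "a \<odot> sum f I = (\<Sum>i\<in>I. a \<odot> f i)"
  using assms
  by (induction I rule: infinite_finite_induct) (auto simp: mul_0_right mul_add_right sum_closed)

lemma star_sum:
  assumes "\<And>i. i \<in> I \<Longrightarrow> f i \<in> A"
  shows "(sum f I)\<^sup>\<star> = (\<Sum>i\<in>I. (f i)\<^sup>\<star>)"
  using assms
  by (induction I rule: infinite_finite_induct) (auto simp: star_0 star_add sum_closed)

lemma tr_sum:
  assumes "\<And>i. i \<in> I \<Longrightarrow> f i \<in> A"
  shows "tr (sum f I) = (\<Sum>i\<in>I. tr (f i))"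
  using assms
  by (induction I rule: infinite_finite_induct) (auto simp: tr_0 tr_add sum_closed)

text \<open>Each summand split off costs a factor 2. The constant is crude, but only its
  independence of the summands matters.\<close>

lemma nrm_sum_le:
  assumes "finite I" "\<And>i. i \<in> I \<Longrightarrow> f i \<in> A"
  shows "nrm (sum f I) \<le> 2 ^ card I * (\<Sum>i\<in>I. nrm (f i))"
  using assms
proof (induction I)
  case empty
  then show ?case by (simp add: nrm_def mul_0_left closed tr_0)
next
  case (insert i I)
  have "nrm (f i + sum f I) \<le> 2 * nrm (f i) + 2 * nrm (sum f I)"
    using insert by (intro nrm_add_le sum_closed) auto
  also have "\<dots> \<le> 2 ^ Suc (card I) * nrm (f i) + 2 * (2 ^ card I * (\<Sum>i\<in>I. nrm (f i)))"
    using insert by (intro add_mono mult_left_mono mult_right_mono) (auto intro: nrm_nonneg)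
  finally show ?case
    using insert by (simp add: algebra_simps)
qed

text \<open>Padding with zeros outside the block lets matrices inherit the vector space structure
  and the zero of the function type, so the abstract theory applies to them verbatim.\<close>

definition matrices :: "nat \<Rightarrow> (nat \<Rightarrow> nat \<Rightarrow> 'a) set" where
  "matrices n = {F. (\<forall>i j. F i j \<in> A) \<and> (\<forall>i j. \<not> (i < n \<and> j < n) \<longrightarrow> F i j = 0)}"

definition matrix_mul :: "nat \<Rightarrow> (nat \<Rightarrow> nat \<Rightarrow> 'a) \<Rightarrow> (nat \<Rightarrow> nat \<Rightarrow> 'a) \<Rightarrow> nat \<Rightarrow> nat \<Rightarrow> 'a" where
  "matrix_mul n F H = (\<lambda>i j. \<Sum>k<n. F i k \<odot> H k j)"

definition matrix_star :: "(nat \<Rightarrow> nat \<Rightarrow> 'a) \<Rightarrow> nat \<Rightarrow> nat \<Rightarrow> 'a" where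
  "matrix_star F = (\<lambda>i j. (F j i)\<^sup>\<star>)"

definition matrix_tr :: "nat \<Rightarrow> (nat \<Rightarrow> nat \<Rightarrow> 'a) \<Rightarrow> real" where
  "matrix_tr n F = (\<Sum>i<n. tr (F i i))"

lemma matrices_closed: "F \<in> matrices n \<Longrightarrow> F i j \<in> A"
  by (simp add: matrices_def)

lemma matrix_tr_mul:
  assumes "F \<in> matrices n" "H \<in> matrices n"
  shows "matrix_tr n (matrix_mul n F H) = (\<Sum>i<n. \<Sum>k<n. tr (F i k \<odot> H k i))"
  using assms by (simp add: matrix_tr_def matrix_mul_def tr_sum matrices_closed closed)

lemma matrix_nrm:
  assumes "F \<in> matrices n"
  shows "matrix_tr n (matrix_mul n F (matrix_star F)) = (\<Sum>i<n. \<Sum>k<n. nrm (F i k))"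
  using assms
  by (simp add: matrix_tr_def matrix_mul_def matrix_star_def tr_sum matrices_closed closed nrm_def)

lemma matrix_mul_closed:
  assumes "F \<in> matrices n" "H \<in> matrices n"
  shows "matrix_mul n F H \<in> matrices n"
  using assms
  by (auto simp: matrices_def matrix_mul_def mul_0_left mul_0_right intro!: sum_closed closed sum.neutral)

lemma matrix_star_closed: "F \<in> matrices n \<Longrightarrow> matrix_star F \<in> matrices n"
  by (auto simp: matrices_def matrix_star_def star_0 closed)

lemma matrix_right_mul_bounded:
  assumes F: "F \<in> matrices n"
  shows "\<exists>B. \<forall>X\<in>matrices n.
    matrix_tr n (matrix_mul n (matrix_mul n X F) (matrix_star (matrix_mul n X F)))
      \<le> B * matrix_tr n (matrix_mul n X (matrix_star X))"
proof -
  have "\<forall>k j. \<exists>B. B \<ge> 1 \<and> (\<forall>x\<in>A. nrm (x \<odot> F k j) \<le> B * nrm x)"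
    using right_mul_boundedE[OF matrices_closed[OF F]] by metis
  then obtain b where b: "\<And>k j. b k j \<ge> 1" "\<And>k j x. x \<in> A \<Longrightarrow> nrm (x \<odot> F k j) \<le> b k j * nrm x"
    by metis
  define B where "B = (\<Sum>j<n. \<Sum>k<n. b k j)"
  have bB: "b k j \<le> B" if "k < n" "j < n" for k j
  proof -
    have "b k j \<le> (\<Sum>k<n. b k j)"
      using that b(1) by (intro member_le_sum) (auto intro: order_trans[OF zero_le_one])
    also have "\<dots> \<le> B"
      unfolding B_def using that b(1)
      by (intro member_le_sum[where f = "\<lambda>j. \<Sum>k<n. b k j"])
         (auto intro!: sum_nonneg intro: order_trans[OF zero_le_one])
    finally show ?thesis .
  qed
  \<comment> \<open>The factor \<open>2 ^ n\<close> comes from splitting an entry into n products, B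
    from bounding each product, and n from the n columns that reuse the same row of X.\<close>
  have "(\<Sum>i<n. \<Sum>j<n. nrm (matrix_mul n X F i j)) \<le> real n * 2 ^ n * B * (\<Sum>i<n. \<Sum>k<n. nrm (X i k))"
    if X: "X \<in> matrices n" for X
  proof -
    have "nrm (matrix_mul n X F i j) \<le> 2 ^ n * B * (\<Sum>k<n. nrm (X i k))" if "j < n" for i j
    proof -
      have "nrm (matrix_mul n X F i j) \<le> 2 ^ card {..<n} * (\<Sum>k<n. nrm (X i k \<odot> F k j))"
        unfolding matrix_mul_def using X F by (intro nrm_sum_le) (auto simp: matrices_closed closed)
      also have "\<dots> \<le> 2 ^ card {..<n} * (\<Sum>k<n. B * nrm (X i k))"
      proof (intro mult_left_mono sum_mono)
        fix k assume "k \<in> {..<n}"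
        then have "nrm (X i k \<odot> F k j) \<le> b k j * nrm (X i k)" "b k j * nrm (X i k) \<le> B * nrm (X i k)"
          using b(2) bB[of k j] \<open>j < n\<close> matrices_closed[OF X] by (auto intro!: mult_right_mono nrm_nonneg)
        then show "nrm (X i k \<odot> F k j) \<le> B * nrm (X i k)" by linarith
      qed auto
      finally show ?thesis by (simp add: sum_distrib_left mult.assoc)
    qed
    then have "(\<Sum>i<n. \<Sum>j<n. nrm (matrix_mul n X F i j)) \<le> (\<Sum>i<n. \<Sum>j<n. 2 ^ n * B * (\<Sum>k<n. nrm (X i k)))"
      by (intro sum_mono) auto
    then show ?thesis by (simp add: sum_distrib_left mult.assoc mult.left_commute)
  qed
  then show ?thesis
    using F matrix_mul_closed by (auto simp: matrix_nrm)
qed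

lemma tracial_star_algebra_matrices:
  "tracial_star_algebra (matrices n) (matrix_mul n) matrix_star (matrix_tr n)"
proof
  show "subspace (matrices n)"
    by (auto simp: matrices_def closed intro!: subspaceI)
  show "matrix_mul n F H \<in> matrices n" if "F \<in> matrices n" "H \<in> matrices n" for F H
    using that by (rule matrix_mul_closed)
  show "matrix_star F \<in> matrices n" if "F \<in> matrices n" for F
    using that by (rule matrix_star_closed)
  fix F assume F: "F \<in> matrices n"
  note FA = matrices_closed[OF F]
  show "matrix_star (matrix_star F) = F" "matrix_star (r *\<^sub>R F) = r *\<^sub>R matrix_star F"
    "matrix_tr n (r *\<^sub>R F) = r * matrix_tr n F" "matrix_tr n (matrix_star F) = matrix_tr n F" for r
    by (auto simp: matrix_star_def matrix_tr_def star_star FA fun_eq_iff star_scaleR tr_scaleR tr_star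
        sum_distrib_left)
  show "matrix_tr n (matrix_mul n F (matrix_star F)) \<ge> 0"
    using F by (auto simp: matrix_nrm FA intro!: sum_nonneg nrm_nonneg)
  show "F = 0" if "matrix_tr n (matrix_mul n F (matrix_star F)) = 0"
  proof -
    have "\<forall>i<n. \<forall>k<n. nrm (F i k) = 0"
      using that F by (subst (asm) matrix_nrm; simp add: sum_nonneg_eq_0_iff sum_nonneg nrm_nonneg FA)
    then have "F i k = 0" for i k
      using tr_faithful[OF FA[of i k]] F by (cases "i < n \<and> k < n") (auto simp: matrices_def nrm_def)
    then show ?thesis by (simp add: fun_eq_iff)
  qed
  fix H assume H: "H \<in> matrices n"
  note HA = matrices_closed[OF H]
  show "matrix_mul n (r *\<^sub>R F) H = r *\<^sub>R matrix_mul n F H"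
    "matrix_mul n F (r *\<^sub>R H) = r *\<^sub>R matrix_mul n F H" for r
    by (auto simp: matrix_mul_def fun_eq_iff mul_scaleR_left mul_scaleR_right FA HA scaleR_sum_right)
  show "matrix_star (F + H) = matrix_star F + matrix_star H"
    "matrix_star (matrix_mul n F H) = matrix_mul n (matrix_star H) (matrix_star F)"
    "matrix_tr n (F + H) = matrix_tr n F + matrix_tr n H"
    by (auto simp: matrix_star_def matrix_mul_def matrix_tr_def fun_eq_iff star_add tr_add FA HA
        star_sum star_mul closed sum.distrib)
  show "matrix_tr n (matrix_mul n F H) = matrix_tr n (matrix_mul n H F)"
    unfolding matrix_tr_mul[OF F H] matrix_tr_mul[OF H F]
    by (subst sum.swap) (simp add: tr_mul_commute FA HA)
  fix L assume L: "L \<in> matrices n"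
  note LA = matrices_closed[OF L]
  show "matrix_mul n (F + H) L = matrix_mul n F L + matrix_mul n H L"
    "matrix_mul n F (H + L) = matrix_mul n F H + matrix_mul n F L"
    by (auto simp: matrix_mul_def fun_eq_iff mul_add_left mul_add_right FA HA LA sum.distrib)
  show "matrix_mul n (matrix_mul n F H) L = matrix_mul n F (matrix_mul n H L)"
  proof (intro ext)
    fix i j
    have "matrix_mul n (matrix_mul n F H) L i j = (\<Sum>k<n. \<Sum>l<n. F i l \<odot> (H l k \<odot> L k j))"
      by (simp add: matrix_mul_def mul_sum_left FA HA LA closed mul_assoc)
    also have "\<dots> = (\<Sum>l<n. \<Sum>k<n. F i l \<odot> (H l k \<odot> L k j))" by (rule sum.swap)
    also have "\<dots> = matrix_mul n F (matrix_mul n H L) i j"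
      by (simp add: matrix_mul_def mul_sum_right FA HA LA closed)
    finally show "matrix_mul n (matrix_mul n F H) L i j = matrix_mul n F (matrix_mul n H L) i j" .
  qed
qed

theorem bounded_tracial_star_algebra_matrices:
  "bounded_tracial_star_algebra (matrices n) (matrix_mul n) matrix_star (matrix_tr n)"
proof -
  interpret M: tracial_star_algebra "matrices n" "matrix_mul n" matrix_star "matrix_tr n"
    by (rule tracial_star_algebra_matrices)
  show ?thesis
    by unfold_locales (use matrix_right_mul_bounded in \<open>simp add: M.nrm_def\<close>)
qed

end

section \<open>Embedding finitely many elements into the complex numbers\<close>

text \<open>\<open>\<Gamma>\<close> is the graph of an isomorphism between a subring of \<open>'a\<close> and a subring of \<open>'b\<close>.\<close>

locale partial_ring_iso =
  fixes \<Gamma> :: "('a::idom \<times> 'b::idom) set"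
  assumes one: "(1, 1) \<in> \<Gamma>"
    and diff: "\<lbrakk>(a, a') \<in> \<Gamma>; (b, b') \<in> \<Gamma>\<rbrakk> \<Longrightarrow> (a - b, a' - b') \<in> \<Gamma>"
    and mult: "\<lbrakk>(a, a') \<in> \<Gamma>; (b, b') \<in> \<Gamma>\<rbrakk> \<Longrightarrow> (a * b, a' * b') \<in> \<Gamma>"
    and zero_iff: "(a, a') \<in> \<Gamma> \<Longrightarrow> a = 0 \<longleftrightarrow> a' = 0"
begin

lemma zero: "(0, 0) \<in> \<Gamma>"
  using diff[OF one one] by simp

lemma add: "\<lbrakk>(a, a') \<in> \<Gamma>; (b, b') \<in> \<Gamma>\<rbrakk> \<Longrightarrow> (a + b, a' + b') \<in> \<Gamma>"
  using diff[of a a' "0 - b" "0 - b'"] diff[OF zero] by simp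

lemma sum: "(\<And>i. i \<in> I \<Longrightarrow> (f i, g i) \<in> \<Gamma>) \<Longrightarrow> (sum f I, sum g I) \<in> \<Gamma>"
  by (induction I rule: infinite_finite_induct) (auto intro: zero add)

lemma eq_iff: "\<lbrakk>(a, a') \<in> \<Gamma>; (b, b') \<in> \<Gamma>\<rbrakk> \<Longrightarrow> a = b \<longleftrightarrow> a' = b'"
  using zero_iff[OF diff, of a a' b b'] by simp

text \<open>The graph of the induced isomorphism between polynomial rings over the two
  subrings.\<close>

definition polys :: "('a poly \<times> 'b poly) set" where
  "polys = {(p, q). \<forall>i. (coeff p i, coeff q i) \<in> \<Gamma>}"

lemma polys_coeff: "(p, q) \<in> polys \<Longrightarrow> (coeff p i, coeff q i) \<in> \<Gamma>"
  by (simp add: polys_def)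

lemma polys_degree: "(p, q) \<in> polys \<Longrightarrow> degree p = degree q"
  using zero_iff[OF polys_coeff] by (simp add: degree_def)

lemma polys_zero_iff: "(p, q) \<in> polys \<Longrightarrow> p = 0 \<longleftrightarrow> q = 0"
  using zero_iff[OF polys_coeff] by (simp add: poly_eq_iff)

lemma polys_0: "(0, 0) \<in> polys"
  by (simp add: polys_def zero)

lemma polys_add: "\<lbrakk>(p, q) \<in> polys; (r, s) \<in> polys\<rbrakk> \<Longrightarrow> (p + r, q + s) \<in> polys"
  by (simp add: polys_def add)

lemma polys_diff: "\<lbrakk>(p, q) \<in> polys; (r, s) \<in> polys\<rbrakk> \<Longrightarrow> (p - r, q - s) \<in> polys"
  by (simp add: polys_def diff)

lemma polys_mult: "\<lbrakk>(p, q) \<in> polys; (r, s) \<in> polys\<rbrakk> \<Longrightarrow> (p * r, q * s) \<in> polys"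
  by (simp add: polys_def coeff_mult sum mult)

lemma polys_smult: "\<lbrakk>(a, b) \<in> \<Gamma>; (p, q) \<in> polys\<rbrakk> \<Longrightarrow> (smult a p, smult b q) \<in> polys"
  by (simp add: polys_def mult)

lemma polys_monom: "(a, b) \<in> \<Gamma> \<Longrightarrow> (monom a n, monom b n) \<in> polys"
  by (simp add: polys_def zero)

lemma polys_const: "(a, b) \<in> \<Gamma> \<Longrightarrow> ([:a:], [:b:]) \<in> polys"
  using polys_monom[of a b 0] by (simp add: monom_0)

lemma countable_polys:
  assumes "countable \<Gamma>"
  shows "countable polys"
proof (rule countable_subset)
  show "polys \<subseteq> (\<lambda>l. (Poly (map fst l), Poly (map snd l))) ` lists \<Gamma>"
  proof clarify
    fix p q assume pq: "(p, q) \<in> polys"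
    define l where "l = map (\<lambda>i. (coeff p i, coeff q i)) [0..<Suc (degree p)]"
    have P: "Poly (map (coeff r) [0..<Suc (degree r)]) = r" for r :: "'c::zero poly"
      by (rule poly_eqI) (auto simp: nth_default_def coeff_eq_0 simp del: upt_Suc)
    \<comment> \<open>Corresponding polynomials have the same degree, so one list of pairs encodes
      both coefficient lists.\<close>
    have "map fst l = map (coeff p) [0..<Suc (degree p)]" "map snd l = map (coeff q) [0..<Suc (degree q)]"
      using polys_degree[OF pq] by (auto simp: l_def)
    then have "(p, q) = (Poly (map fst l), Poly (map snd l))" by (simp only: P)
    moreover have "l \<in> lists \<Gamma>" using polys_coeff[OF pq] by (auto simp: l_def simp del: upt_Suc)
    ultimately show "(p, q) \<in> (\<lambda>l. (Poly (map fst l), Poly (map snd l))) ` lists \<Gamma>" by blast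
  qed
  show "countable ((\<lambda>l. (Poly (map fst l), Poly (map snd l))) ` lists \<Gamma>)"
    using assms by simp
qed

text \<open>Over a domain, division with remainder works after scaling the dividend by a nonzero l.
  The same steps run in parallel on both sides of the relation, so quotients and remainders
  correspond again.\<close>

lemma pseudo_division:
  assumes m: "(m, m') \<in> polys" "m \<noteq> 0" and "(p, p') \<in> polys"
  obtains l l' s s' r r' where "(l, l') \<in> \<Gamma>" "l \<noteq> 0" "(s, s') \<in> polys" "(r, r') \<in> polys"
    "smult l p = s * m + r" "smult l' p' = s' * m' + r'" "r = 0 \<or> degree r < degree m"
proof -
  have "\<exists>l l' s s' r r'. (l, l') \<in> \<Gamma> \<and> l \<noteq> 0 \<and> (s, s') \<in> polys \<and> (r, r') \<in> polys \<and>
    smult l p = s * m + r \<and> smult l' p' = s' * m' + r' \<and> (r = 0 \<or> degree r < degree m)"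
    if "(p, p') \<in> polys" "p = 0 \<or> degree p < d" for d p p'
    using that
  proof (induction d arbitrary: p p')
    case 0
    then show ?case using one polys_0 polys_zero_iff by force
  next
    case (Suc d)
    show ?case
    proof (cases "p = 0 \<or> degree p < degree m")
      case True
      then show ?thesis using one polys_0 Suc.prems by force
    next
      case False
      \<comment> \<open>Cross-multiplying by the leading coefficients cancels the top term of p
        without dividing.\<close>
      define k where "k = degree p - degree m"
      define p1 where "p1 = smult (lead_coeff m) p - monom (lead_coeff p) k * m"
      define p1' where "p1' = smult (lead_coeff m') p' - monom (lead_coeff p') k * m'"
      have dm: "degree m' = degree m" "degree p' = degree p"
        using polys_degree m Suc.prems by metis+
      have lc: "(lead_coeff m, lead_coeff m') \<in> \<Gamma>" "(lead_coeff p, lead_coeff p') \<in> \<Gamma>"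
        unfolding dm using polys_coeff m Suc.prems by blast+
      have p1: "(p1, p1') \<in> polys"
        unfolding p1_def p1'_def using m Suc.prems lc
        by (intro polys_diff polys_smult polys_mult polys_monom)
      have "degree p1 \<le> degree p"
        unfolding p1_def using False
        by (intro degree_diff_le degree_smult_le order_trans[OF degree_mult_le])
           (auto simp: k_def degree_monom_eq)
      moreover have "coeff p1 (degree p) = 0"
        using False by (simp add: p1_def k_def coeff_monom_mult)
      ultimately have "p1 = 0 \<or> degree p1 < degree p"
        by (metis le_neq_implies_less leading_coeff_0_iff)
      then have "p1 = 0 \<or> degree p1 < d" using Suc.prems False by auto
      then obtain l l' s s' r r' where IH: "(l, l') \<in> \<Gamma>" "l \<noteq> 0" "(s, s') \<in> polys" "(r, r') \<in> polys"
        "smult l p1 = s * m + r" "smult l' p1' = s' * m' + r'" "r = 0 \<or> degree r < degree m"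
        using Suc.IH[OF p1] by blast
      define t where "t = s + smult l (monom (lead_coeff p) k)"
      define t' where "t' = s' + smult l' (monom (lead_coeff p') k)"
      have "(t, t') \<in> polys"
        unfolding t_def t'_def using IH lc by (intro polys_add polys_smult polys_monom)
      moreover have "smult (l * lead_coeff m) p = t * m + r"
        using IH(5) by (simp add: p1_def t_def algebra_simps smult_diff_right)
      moreover have "smult (l' * lead_coeff m') p' = t' * m' + r'"
        using IH(6) by (simp add: p1'_def t'_def algebra_simps smult_diff_right)
      moreover have "(l * lead_coeff m, l' * lead_coeff m') \<in> \<Gamma>" "l * lead_coeff m \<noteq> 0"
        using IH lc m by (auto intro: mult)
      ultimately show ?thesis using IH(4,7) by blast
    qed
  qed
  from this[of p p' "Suc (degree p)"] show thesis using assms that by auto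
qed

text \<open>If b and c satisfy corresponding polynomial relations, then p(b) \<mapsto> q(c) is well
  defined and injective; the image is the relation with b and c adjoined.\<close>

lemma partial_ring_iso_poly_image:
  assumes "\<And>p q. (p, q) \<in> polys \<Longrightarrow> poly p b = 0 \<longleftrightarrow> poly q c = 0"
  shows "partial_ring_iso ((\<lambda>(p, q). (poly p b, poly q c)) ` polys)"
proof
  have im: "(poly p b, poly q c) \<in> (\<lambda>(p, q). (poly p b, poly q c)) ` polys" if "(p, q) \<in> polys" for p q
    using that by force
  show "(1, 1) \<in> (\<lambda>(p, q). (poly p b, poly q c)) ` polys"
    using im[OF polys_const[OF one]] by simp
  fix x x' assume "(x, x') \<in> (\<lambda>(p, q). (poly p b, poly q c)) ` polys"
  then obtain p q where pq: "(p, q) \<in> polys" "x = poly p b" "x' = poly q c" by auto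
  then show "x = 0 \<longleftrightarrow> x' = 0" using assms by simp
  fix y y' assume "(y, y') \<in> (\<lambda>(p, q). (poly p b, poly q c)) ` polys"
  then obtain r s where rs: "(r, s) \<in> polys" "y = poly r b" "y' = poly s c" by auto
  show "(x - y, x' - y') \<in> (\<lambda>(p, q). (poly p b, poly q c)) ` polys"
    using im[OF polys_diff[OF pq(1) rs(1)]] pq rs by simp
  show "(x * y, x' * y') \<in> (\<lambda>(p, q). (poly p b, poly q c)) ` polys"
    using im[OF polys_mult[OF pq(1) rs(1)]] pq rs by simp
qed

end

text \<open>If b is transcendental over the subring, any c avoiding the countably many roots of the
  nonzero image polynomials will do; this is what countability is for. If b is algebraic, c is a
  root of the image of a relation of least degree.\<close>

lemma partial_ring_iso_extend:
  fixes \<Gamma> :: "('a::idom \<times> complex) set" and b :: 'a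
  assumes "partial_ring_iso \<Gamma>" "countable \<Gamma>"
  obtains \<Gamma>' where "partial_ring_iso \<Gamma>'" "countable \<Gamma>'" "\<Gamma> \<subseteq> \<Gamma>'" "b \<in> fst ` \<Gamma>'"
proof -
  interpret partial_ring_iso \<Gamma> by fact
  have "\<exists>c. \<forall>(p, q)\<in>polys. poly p b = 0 \<longleftrightarrow> poly q c = 0"
  proof (cases "\<exists>(p, q)\<in>polys. p \<noteq> 0 \<and> poly p b = 0")
    case False
    have "countable (\<Union>q\<in>snd ` polys - {0}. {c. poly q c = 0})"
      using countable_polys[OF assms(2)]
      by (intro countable_UN) (auto intro!: countable_finite poly_roots_finite)
    then have "(\<Union>q\<in>snd ` polys - {0}. {c. poly q c = 0}) \<noteq> UNIV"
      using uncountable_UNIV_complex by metis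
    then obtain c where c: "c \<notin> (\<Union>q\<in>snd ` polys - {0}. {c. poly q c = 0})"
      by (metis UNIV_eq_I)
    have "poly p b = 0 \<longleftrightarrow> poly q c = 0" if pq: "(p, q) \<in> polys" for p q
    proof (cases "p = 0")
      case True
      then show ?thesis using polys_zero_iff[OF pq] by simp
    next
      case p0: False
      then have "poly p b \<noteq> 0" using False pq by blast
      moreover have "q \<in> snd ` polys - {0}"
        using p0 polys_zero_iff[OF pq] pq by (auto simp: image_iff intro!: bexI[of _ "(p, q)"])
      ultimately show ?thesis using c by blast
    qed
    then have "\<forall>(p, q)\<in>polys. poly p b = 0 \<longleftrightarrow> poly q c = 0" by blast
    then show ?thesis ..
  next
    case True
    let ?P = "\<lambda>d. \<exists>p q. (p, q) \<in> polys \<and> p \<noteq> 0 \<and> poly p b = 0 \<and> degree p = d"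
    define d where "d = (LEAST d. ?P d)"
    have "\<exists>d. ?P d" using True by blast
    then have "?P d" unfolding d_def by (rule LeastI_ex)
    then obtain p q where pq: "(p, q) \<in> polys" "p \<noteq> 0" "poly p b = 0" "degree p = d" by blast
    have p_min: "r = 0" if "(r, s) \<in> polys" "poly r b = 0" "degree r < d" for r s
      using not_less_Least[of "degree r" ?P] that unfolding d_def by blast
    have degree_pos: "degree r > 0" if "r \<noteq> 0" "poly r x = 0" for r :: "'c::idom poly" and x
      using that by (cases "degree r = 0") (auto elim!: degree_eq_zeroE)
    have "degree q > 0"
      using degree_pos[OF pq(2,3)] polys_degree[OF pq(1)] by simp
    then obtain c where c: "poly q c = 0"
      by (metis fundamental_theorem_of_algebra constant_degree less_irrefl)
    \<comment> \<open>The root c might satisfy relations of smaller degree than q. Comparing p with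
      a least relation n of c, pulled back to m, excludes foreign relations; it replaces an appeal
      to irreducibility over the fraction field.\<close>
    let ?Q = "\<lambda>d. \<exists>m n. (m, n) \<in> polys \<and> m \<noteq> 0 \<and> poly n c = 0 \<and> degree m = d"
    define e where "e = (LEAST d. ?Q d)"
    have "?Q d" using pq c by blast
    then have "?Q e" unfolding e_def by (rule LeastI)
    then obtain m n where mn: "(m, n) \<in> polys" "m \<noteq> 0" "poly n c = 0" "degree m = e" by blast
    have m_min: "r = 0" if "(r, s) \<in> polys" "poly s c = 0" "degree r < e" for r s
      using not_less_Least[of "degree r" ?Q] that unfolding e_def by blast
    have e: "e > 0"
      using degree_pos[of n c] mn polys_degree[OF mn(1)] polys_zero_iff[OF mn(1)] by simp
    have dvd: "\<exists>l s. l \<noteq> 0 \<and> smult l g = s * m \<and> (\<exists>s'. (s, s') \<in> polys)"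
      if gh: "(g, h) \<in> polys" "poly h c = 0" for g h
    proof -
      obtain l l' s s' r r' where *: "(l, l') \<in> \<Gamma>" "l \<noteq> 0" "(s, s') \<in> polys" "(r, r') \<in> polys"
        "smult l g = s * m + r" "smult l' h = s' * n + r'" "r = 0 \<or> degree r < degree m"
        using pseudo_division[OF mn(1,2) gh(1)] by metis
      have "poly r' c = 0" using arg_cong[OF *(6), of "\<lambda>p. poly p c"] gh mn by simp
      then have "r = 0" using m_min[OF *(4)] *(7) mn(4) by auto
      then show ?thesis using * by auto
    qed
    have mb: "poly m b = 0"
    proof -
      obtain l s s' where s: "l \<noteq> 0" "smult l p = s * m" "(s, s') \<in> polys"
        using dvd[OF pq(1) c] by blast
      have s0: "s \<noteq> 0" using s pq(2) by auto
      \<comment> \<open>Since e > 0, the cofactor s has smaller degree than p and cannot vanish at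
        b, so m must.\<close>
      have "degree s + e = d"
        using arg_cong[OF s(2), of degree] s0 mn s(1) pq(4) by (simp add: degree_mult_eq)
      then have "poly s b \<noteq> 0" using p_min[OF s(3)] s0 e by auto
      moreover have "poly s b * poly m b = 0"
        using arg_cong[OF s(2), of "\<lambda>p. poly p b"] pq by simp
      ultimately show ?thesis by simp
    qed
    have "poly g b = 0 \<longleftrightarrow> poly h c = 0" if gh: "(g, h) \<in> polys" for g h
    proof
      assume "poly h c = 0"
      then obtain l s where l: "l \<noteq> 0" "smult l g = s * m" using dvd gh by blast
      show "poly g b = 0"
        using arg_cong[OF l(2), of "\<lambda>p. poly p b"] l(1) mb by simp
    next
      assume g: "poly g b = 0"
      obtain l l' s s' r r' where *: "(l, l') \<in> \<Gamma>" "l \<noteq> 0" "(s, s') \<in> polys" "(r, r') \<in> polys"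
        "smult l g = s * p + r" "smult l' h = s' * q + r'" "r = 0 \<or> degree r < degree p"
        using pseudo_division[OF pq(1,2) gh] by metis
      have "poly r b = 0" using arg_cong[OF *(5), of "\<lambda>p. poly p b"] g pq by simp
      then have "r = 0" using p_min[OF *(4)] *(7) pq(4) by auto
      then have "r' = 0" using polys_zero_iff[OF *(4)] by simp
      then show "poly h c = 0"
        using arg_cong[OF *(6), of "\<lambda>p. poly p c"] c zero_iff[OF *(1)] *(2) by simp
    qed
    then show ?thesis by blast
  qed
  then obtain c where c: "\<And>p q. (p, q) \<in> polys \<Longrightarrow> poly p b = 0 \<longleftrightarrow> poly q c = 0" by blast
  show thesis
  proof (rule that[OF partial_ring_iso_poly_image[OF c]])
    show "countable ((\<lambda>(p, q). (poly p b, poly q c)) ` polys)"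
      using countable_polys[OF assms(2)] by simp
    show "\<Gamma> \<subseteq> (\<lambda>(p, q). (poly p b, poly q c)) ` polys"
      using polys_const by force
    show "b \<in> fst ` (\<lambda>(p, q). (poly p b, poly q c)) ` polys"
      using polys_monom[OF one, of 1] by (force simp: poly_monom)
  qed simp_all
qed

text \<open>Characteristic zero identifies the two copies of the integers; the elements of S are
  then adjoined one by one, and the relation stays countable for the next transcendental
  step.\<close>

theorem finite_set_in_partial_ring_iso:
  fixes S :: "'a::{idom, ring_char_0} set"
  assumes "finite S"
  obtains \<Gamma> :: "('a \<times> complex) set" where "partial_ring_iso \<Gamma>" "S \<subseteq> fst ` \<Gamma>"
proof -
  have "\<exists>\<Gamma> :: ('a \<times> complex) set. partial_ring_iso \<Gamma> \<and> countable \<Gamma> \<and> S \<subseteq> fst ` \<Gamma>"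
    using assms
  proof (induction S)
    case empty
    let ?\<Gamma> = "range (\<lambda>z. (of_int z, of_int z)) :: ('a \<times> complex) set"
    have im: "(of_int z, of_int z) \<in> ?\<Gamma>" for z by blast
    have "partial_ring_iso ?\<Gamma>"
    proof
      show "(1, 1) \<in> ?\<Gamma>" using im[of 1] by simp
      fix a a' b b' assume "(a, a') \<in> ?\<Gamma>" "(b, b') \<in> ?\<Gamma>"
      then obtain x y where "a = of_int x" "a' = of_int x" "b = of_int y" "b' = of_int y" by blast
      then show "(a - b, a' - b') \<in> ?\<Gamma>" "(a * b, a' * b') \<in> ?\<Gamma>"
        using im[of "x - y"] im[of "x * y"] by simp_all
    qed auto
    moreover have "countable ?\<Gamma>" by simp
    ultimately show ?case by blast
  next
    case (insert b S)
    then obtain \<Gamma> :: "('a \<times> complex) set" where "partial_ring_iso \<Gamma>" "countable \<Gamma>" "S \<subseteq> fst ` \<Gamma>" by blast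
    moreover from this obtain \<Gamma>' where "partial_ring_iso \<Gamma>'" "countable \<Gamma>'" "\<Gamma> \<subseteq> \<Gamma>'" "b \<in> fst ` \<Gamma>'"
      using partial_ring_iso_extend[of \<Gamma> b] by blast
    ultimately show ?case by (intro exI[of _ \<Gamma>']) auto
  qed
  then show thesis using that by blast
qed

section \<open>The convolution algebra of an ample groupoid\<close>

context groupoid
begin

lemma composable_iff:
  "(\<alpha>, \<beta>) \<in> composable G \<longleftrightarrow> \<alpha> \<in> arrows G \<and> \<beta> \<in> arrows G \<and> gdom G \<alpha> = gran G \<beta>"
  by (simp add: composable_def)

lemma dom_closed: "\<gamma> \<in> arrows G \<Longrightarrow> gdom G \<gamma> \<in> arrows G"
  using comp_closed[of "ginv G \<gamma>" \<gamma>]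
  by (auto simp: composable_iff inv_closed dom_inv gdom_def[of G \<gamma>])

lemma dom_dom: "\<gamma> \<in> arrows G \<Longrightarrow> gdom G (gdom G \<gamma>) = gdom G \<gamma>"
  and ran_dom: "\<gamma> \<in> arrows G \<Longrightarrow> gran G (gdom G \<gamma>) = gdom G \<gamma>"
  using dom_comp[of "ginv G \<gamma>" \<gamma>] ran_comp[of "ginv G \<gamma>" \<gamma>]
  by (simp_all add: composable_iff inv_closed dom_inv ran_inv flip: gdom_def)

lemma ran_in_units: "\<gamma> \<in> arrows G \<Longrightarrow> gran G \<gamma> \<in> units G"
  unfolding units_def by (rule image_eqI[of _ _ "ginv G \<gamma>"]) (auto simp: dom_inv inv_closed)

lemma unitsD:
  assumes "x \<in> units G" shows "x \<in> arrows G" "gdom G x = x" "gran G x = x"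
  using assms by (auto simp: units_def dom_closed dom_dom ran_dom)

lemma units_subset: "units G \<subseteq> arrows G"
  using unitsD by blast

lemma topspace_unit_top: "topspace (unit_top G) = units G"
  using units_subset by (auto simp: unit_top_def)

lemma inv_comp_cancel: "(\<alpha>, \<beta>) \<in> composable G \<Longrightarrow> gcomp G (ginv G \<alpha>) (gcomp G \<alpha> \<beta>) = \<beta>"
  using comp_assoc[of "ginv G \<alpha>" \<alpha> \<beta>]
  by (simp add: composable_iff inv_closed dom_inv ran_comp_self flip: gdom_def)

lemma composable_inv_left:
  assumes "\<alpha> \<in> arrows G" "\<gamma> \<in> arrows G" "gran G \<alpha> = gran G \<gamma>"
  shows "(ginv G \<alpha>, \<gamma>) \<in> composable G" "(\<alpha>, gcomp G (ginv G \<alpha>) \<gamma>) \<in> composable G"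
    "gcomp G \<alpha> (gcomp G (ginv G \<alpha>) \<gamma>) = \<gamma>"
proof -
  show c: "(ginv G \<alpha>, \<gamma>) \<in> composable G"
    using assms by (simp add: composable_iff inv_closed dom_inv)
  show "(\<alpha>, gcomp G (ginv G \<alpha>) \<gamma>) \<in> composable G"
    using assms c by (simp add: composable_iff comp_closed ran_comp ran_inv)
  show "gcomp G \<alpha> (gcomp G (ginv G \<alpha>) \<gamma>) = \<gamma>"
    using comp_assoc[of \<alpha> "ginv G \<alpha>" \<gamma>] assms c
    by (simp add: composable_iff inv_closed ran_inv ran_comp_self flip: gran_def)
qed

lemma inv_unique:
  assumes "(\<alpha>, \<beta>) \<in> composable G" "gcomp G \<alpha> \<beta> = gran G \<alpha>"
  shows "\<beta> = ginv G \<alpha>"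
  using inv_comp_cancel[OF assms(1)] comp_dom[of "ginv G \<alpha>"] assms
  by (simp add: composable_iff inv_closed dom_inv)

lemma inv_inv: "\<gamma> \<in> arrows G \<Longrightarrow> ginv G (ginv G \<gamma>) = \<gamma>"
  using inv_unique[of "ginv G \<gamma>" \<gamma>]
  by (simp add: composable_iff inv_closed dom_inv ran_inv flip: gdom_def)

lemma inv_unit: "x \<in> units G \<Longrightarrow> ginv G x = x"
  using inv_unique[of x x] comp_dom[of x] unitsD[of x] by (simp add: composable_iff)

lemma inv_comp:
  assumes "(\<alpha>, \<beta>) \<in> composable G"
  shows "ginv G (gcomp G \<alpha> \<beta>) = gcomp G (ginv G \<beta>) (ginv G \<alpha>)"
proof (rule inv_unique[symmetric])
  have A: "\<alpha> \<in> arrows G" "\<beta> \<in> arrows G" "gdom G \<alpha> = gran G \<beta>"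
    using assms by (auto simp: composable_iff)
  have c: "(ginv G \<beta>, ginv G \<alpha>) \<in> composable G"
    using A by (simp add: composable_iff inv_closed dom_inv ran_inv)
  show "(gcomp G \<alpha> \<beta>, gcomp G (ginv G \<beta>) (ginv G \<alpha>)) \<in> composable G"
    using A assms c by (simp add: composable_iff comp_closed dom_comp ran_comp ran_inv)
  have "gcomp G (gcomp G \<alpha> \<beta>) (gcomp G (ginv G \<beta>) (ginv G \<alpha>)) =
      gcomp G \<alpha> (gcomp G \<beta> (gcomp G (ginv G \<beta>) (ginv G \<alpha>)))"
    using A assms c by (intro comp_assoc) (auto simp: composable_iff comp_closed ran_comp ran_inv)
  also have "\<dots> = gran G \<alpha>"
    using A by (simp add: composable_inv_left inv_closed ran_inv flip: gran_def)
  finally show "gcomp G (gcomp G \<alpha> \<beta>) (gcomp G (ginv G \<beta>) (ginv G \<alpha>)) = gran G (gcomp G \<alpha> \<beta>)"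
    using assms by (simp add: ran_comp)
qed

lemma set_comp_subset: "set_comp G U V \<subseteq> arrows G"
  by (auto simp: set_comp_def comp_closed)

lemma set_comp_assoc:
  assumes "U \<subseteq> arrows G" "V \<subseteq> arrows G" "W \<subseteq> arrows G"
  shows "set_comp G (set_comp G U V) W = set_comp G U (set_comp G V W)"
proof (intro equalityI subsetI)
  fix x assume "x \<in> set_comp G (set_comp G U V) W"
  then obtain \<alpha> \<beta> \<gamma> where *: "\<alpha> \<in> U" "\<beta> \<in> V" "\<gamma> \<in> W" "(\<alpha>, \<beta>) \<in> composable G"
    "(gcomp G \<alpha> \<beta>, \<gamma>) \<in> composable G" "x = gcomp G (gcomp G \<alpha> \<beta>) \<gamma>"
    by (auto simp: set_comp_def)
  then have "(\<beta>, \<gamma>) \<in> composable G" by (simp add: composable_iff dom_comp)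
  moreover from this * have "(\<alpha>, gcomp G \<beta> \<gamma>) \<in> composable G"
    by (simp add: composable_iff ran_comp comp_closed)
  ultimately show "x \<in> set_comp G U (set_comp G V W)"
    unfolding set_comp_def using * comp_assoc by blast
next
  fix x assume "x \<in> set_comp G U (set_comp G V W)"
  then obtain \<alpha> \<beta> \<gamma> where *: "\<alpha> \<in> U" "\<beta> \<in> V" "\<gamma> \<in> W" "(\<beta>, \<gamma>) \<in> composable G"
    "(\<alpha>, gcomp G \<beta> \<gamma>) \<in> composable G" "x = gcomp G \<alpha> (gcomp G \<beta> \<gamma>)"
    by (auto simp: set_comp_def)
  then have c: "(\<alpha>, \<beta>) \<in> composable G" by (simp add: composable_iff ran_comp)
  moreover from this * have "(gcomp G \<alpha> \<beta>, \<gamma>) \<in> composable G"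
    by (simp add: composable_iff dom_comp comp_closed)
  moreover have "x = gcomp G (gcomp G \<alpha> \<beta>) \<gamma>" using * c comp_assoc by simp
  ultimately show "x \<in> set_comp G (set_comp G U V) W"
    unfolding set_comp_def using * by blast
qed

lemma set_inv_subset: "U \<subseteq> arrows G \<Longrightarrow> set_inv G U \<subseteq> arrows G"
  by (auto simp: set_inv_def inv_closed)

lemma mem_set_inv:
  assumes "U \<subseteq> arrows G" "\<gamma> \<in> arrows G" shows "\<gamma> \<in> set_inv G U \<longleftrightarrow> ginv G \<gamma> \<in> U"
proof
  show "ginv G \<gamma> \<in> U" if "\<gamma> \<in> set_inv G U"
    using that assms(1) by (auto simp: set_inv_def inv_inv subset_iff)
  show "\<gamma> \<in> set_inv G U" if "ginv G \<gamma> \<in> U"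
    using imageI[OF that, of "ginv G"] assms(2) by (simp add: set_inv_def inv_inv)
qed

lemma set_inv_set_inv: "U \<subseteq> arrows G \<Longrightarrow> set_inv G (set_inv G U) = U"
  by (auto simp: set_inv_def inv_inv subset_iff image_iff)

lemma set_inv_comp:
  assumes "U \<subseteq> arrows G" "V \<subseteq> arrows G"
  shows "set_inv G (set_comp G U V) = set_comp G (set_inv G V) (set_inv G U)"
proof -
  have sub: "set_inv G (set_comp G U V) \<subseteq> set_comp G (set_inv G V) (set_inv G U)" for U V
  proof
    fix x assume "x \<in> set_inv G (set_comp G U V)"
    then obtain \<alpha> \<beta> where *: "\<alpha> \<in> U" "\<beta> \<in> V" "(\<alpha>, \<beta>) \<in> composable G" "x = ginv G (gcomp G \<alpha> \<beta>)"
      by (auto simp: set_inv_def set_comp_def)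
    then have "(ginv G \<beta>, ginv G \<alpha>) \<in> composable G"
      by (simp add: composable_iff inv_closed dom_inv ran_inv)
    then show "x \<in> set_comp G (set_inv G V) (set_inv G U)"
      unfolding set_comp_def set_inv_def using * inv_comp by blast
  qed
  \<comment> \<open>The reverse inclusion is the one just shown, applied to the inverse sets and
    inverted once more.\<close>
  have "set_comp G (set_inv G V) (set_inv G U) = set_inv G (set_inv G (set_comp G (set_inv G V) (set_inv G U)))"
    by (simp add: set_inv_set_inv set_comp_subset)
  also have "\<dots> \<subseteq> set_inv G (set_comp G (set_inv G (set_inv G U)) (set_inv G (set_inv G V)))"
    using image_mono[OF sub[of "set_inv G V" "set_inv G U"], of "ginv G"] by (simp add: set_inv_def)
  finally show ?thesis
    using sub assms by (simp add: set_inv_set_inv subset_antisym)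
qed

section \<open>Convolution as a finite sum over arrows with a given range\<close>

lemma convolution_outside: "\<gamma> \<notin> arrows G \<Longrightarrow> convolution G f g \<gamma> = 0"
  unfolding convolution_def by (rule sum.neutral) (use comp_closed in auto)

text \<open>A factorisation of \<gamma> is determined by its left factor \<alpha>. The index set may
  exceed the support of f, so that several functions can be summed over a common one.\<close>

lemma convolution_eq_sum:
  fixes f g :: "'g \<Rightarrow> 'k::comm_ring_1"
  assumes \<gamma>: "\<gamma> \<in> arrows G" and S: "finite S" "S \<subseteq> {\<alpha> \<in> arrows G. gran G \<alpha> = gran G \<gamma>}"
    and f: "{\<alpha> \<in> arrows G. gran G \<alpha> = gran G \<gamma> \<and> f \<alpha> \<noteq> 0} \<subseteq> S"
  shows "convolution G f g \<gamma> = (\<Sum>\<alpha>\<in>S. f \<alpha> * g (gcomp G (ginv G \<alpha>) \<gamma>))"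
proof -
  let ?T = "{(\<alpha>, \<beta>). (\<alpha>, \<beta>) \<in> composable G \<and> gcomp G \<alpha> \<beta> = \<gamma> \<and> f \<alpha> * g \<beta> \<noteq> 0}"
  let ?S = "{\<alpha> \<in> S. f \<alpha> * g (gcomp G (ginv G \<alpha>) \<gamma>) \<noteq> 0}"
  have T: "\<alpha> \<in> S \<and> gcomp G (ginv G \<alpha>) \<gamma> = \<beta>" if "(\<alpha>, \<beta>) \<in> ?T" for \<alpha> \<beta>
  proof -
    from that have c: "(\<alpha>, \<beta>) \<in> composable G" and g: "gcomp G \<alpha> \<beta> = \<gamma>" and "f \<alpha> \<noteq> 0" by auto
    then have "\<alpha> \<in> S" using f ran_comp[OF c] by (auto simp: composable_iff)
    then show ?thesis using inv_comp_cancel[OF c] g by simp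
  qed
  have S': "(\<alpha>, gcomp G (ginv G \<alpha>) \<gamma>) \<in> composable G \<and> gcomp G \<alpha> (gcomp G (ginv G \<alpha>) \<gamma>) = \<gamma>"
    if "\<alpha> \<in> S" for \<alpha>
    using composable_inv_left[of \<alpha> \<gamma>] that S \<gamma> by auto
  have "(\<Sum>(\<alpha>, \<beta>)\<in>?T. f \<alpha> * g \<beta>) = (\<Sum>\<alpha>\<in>?S. f \<alpha> * g (gcomp G (ginv G \<alpha>) \<gamma>))"
    by (rule sum.reindex_bij_witness[of _ "\<lambda>\<alpha>. (\<alpha>, gcomp G (ginv G \<alpha>) \<gamma>)" fst])
       (use T S' in \<open>fastforce+\<close>)
  also have "\<dots> = (\<Sum>\<alpha>\<in>S. f \<alpha> * g (gcomp G (ginv G \<alpha>) \<gamma>))"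
    using S(1) by (intro sum.mono_neutral_left) auto
  finally show ?thesis by (simp add: convolution_def)
qed

text \<open>Guards against the default value 0 of infinite sums: without such finiteness the sum
  defining \<open>convolution\<close> could collapse and additivity fail.\<close>

definition row_finite :: "('g \<Rightarrow> 'k::comm_ring_1) \<Rightarrow> bool" where
  "row_finite f \<longleftrightarrow> (\<forall>x. finite {\<alpha> \<in> arrows G. gran G \<alpha> = x \<and> f \<alpha> \<noteq> 0})"

lemma row_finite_add: "row_finite f \<Longrightarrow> row_finite g \<Longrightarrow> row_finite (f + g)"
  unfolding row_finite_def
proof (intro allI)
  fix x assume *: "\<forall>x. finite {\<alpha> \<in> arrows G. gran G \<alpha> = x \<and> f \<alpha> \<noteq> 0}"
    "\<forall>x. finite {\<alpha> \<in> arrows G. gran G \<alpha> = x \<and> g \<alpha> \<noteq> 0}"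
  show "finite {\<alpha> \<in> arrows G. gran G \<alpha> = x \<and> (f + g) \<alpha> \<noteq> 0}"
    by (rule finite_subset[OF _ finite_UnI[OF *[THEN spec, of x]]]) auto
qed

lemma row_finite_smult: "row_finite f \<Longrightarrow> row_finite (\<lambda>\<gamma>. c * f \<gamma>)"
  unfolding row_finite_def
proof
  fix x assume *: "\<forall>x. finite {\<alpha> \<in> arrows G. gran G \<alpha> = x \<and> f \<alpha> \<noteq> 0}"
  show "finite {\<alpha> \<in> arrows G. gran G \<alpha> = x \<and> c * f \<alpha> \<noteq> 0}"
    by (rule finite_subset[OF _ *[THEN spec, of x]]) auto
qed

lemma row_finite_indicator:
  assumes "inj_on (gran G) U" shows "row_finite (indicator U :: 'g \<Rightarrow> 'k::comm_ring_1)"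
  unfolding row_finite_def
proof
  fix x
  have "{\<alpha> \<in> arrows G. gran G \<alpha> = x \<and> (indicator U \<alpha> :: 'k) \<noteq> 0} \<subseteq> {THE \<alpha>. \<alpha> \<in> U \<and> gran G \<alpha> = x}"
    using assms by (auto simp: indicator_def inj_on_def intro!: the_equality[symmetric] split: if_splits)
  then show "finite {\<alpha> \<in> arrows G. gran G \<alpha> = x \<and> (indicator U \<alpha> :: 'k) \<noteq> 0}"
    by (rule finite_subset) simp
qed

lemma convolution_add_left:
  assumes "row_finite f" "row_finite g"
  shows "convolution G (f + g) h = convolution G f h + convolution G g h"
proof
  fix \<gamma>
  show "convolution G (f + g) h \<gamma> = (convolution G f h + convolution G g h) \<gamma>"
  proof (cases "\<gamma> \<in> arrows G")
    case True
    define S where "S = {\<alpha> \<in> arrows G. gran G \<alpha> = gran G \<gamma> \<and> f \<alpha> \<noteq> 0} \<union>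
      {\<alpha> \<in> arrows G. gran G \<alpha> = gran G \<gamma> \<and> g \<alpha> \<noteq> 0}"
    have "finite S" using assms by (auto simp: S_def row_finite_def)
    then have "convolution G q h \<gamma> = (\<Sum>\<alpha>\<in>S. q \<alpha> * h (gcomp G (ginv G \<alpha>) \<gamma>))" if "q \<in> {f, g, f + g}" for q
      using that by (intro convolution_eq_sum True) (auto simp: S_def)
    then show ?thesis by (simp add: sum.distrib algebra_simps)
  qed (simp add: convolution_outside)
qed

lemma convolution_add_right:
  assumes "row_finite f"
  shows "convolution G f (g + h) = convolution G f g + convolution G f h"
proof
  fix \<gamma>
  show "convolution G f (g + h) \<gamma> = (convolution G f g + convolution G f h) \<gamma>"
  proof (cases "\<gamma> \<in> arrows G")
    case True
    define S where "S = {\<alpha> \<in> arrows G. gran G \<alpha> = gran G \<gamma> \<and> f \<alpha> \<noteq> 0}"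
    have "finite S" using assms by (auto simp: S_def row_finite_def)
    then have "convolution G f q \<gamma> = (\<Sum>\<alpha>\<in>S. f \<alpha> * q (gcomp G (ginv G \<alpha>) \<gamma>))" for q
      by (intro convolution_eq_sum True) (auto simp: S_def)
    then show ?thesis by (simp add: sum.distrib algebra_simps)
  qed (simp add: convolution_outside)
qed

lemma convolution_smult:
  assumes "row_finite f"
  shows "convolution G (\<lambda>\<gamma>. a * f \<gamma>) (\<lambda>\<gamma>. b * g \<gamma>) = (\<lambda>\<gamma>. a * b * convolution G f g \<gamma>)"
proof
  fix \<gamma>
  show "convolution G (\<lambda>\<gamma>. a * f \<gamma>) (\<lambda>\<gamma>. b * g \<gamma>) \<gamma> = a * b * convolution G f g \<gamma>"
  proof (cases "\<gamma> \<in> arrows G")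
    case True
    define S where "S = {\<alpha> \<in> arrows G. gran G \<alpha> = gran G \<gamma> \<and> f \<alpha> \<noteq> 0}"
    have "finite S" using assms by (auto simp: S_def row_finite_def)
    then have "convolution G f g \<gamma> = (\<Sum>\<alpha>\<in>S. f \<alpha> * g (gcomp G (ginv G \<alpha>) \<gamma>))"
      "convolution G (\<lambda>\<gamma>. a * f \<gamma>) (\<lambda>\<gamma>. b * g \<gamma>) \<gamma> =
        (\<Sum>\<alpha>\<in>S. a * f \<alpha> * (b * g (gcomp G (ginv G \<alpha>) \<gamma>)))"
      by (subst convolution_eq_sum[OF True, of S]; auto simp: S_def)+
    then show ?thesis by (simp add: sum_distrib_left algebra_simps)
  qed (simp add: convolution_outside)
qed

text \<open>Injectivity of the range map on U leaves at most one possible left factor, so no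
  multiplicity greater than 1 can occur.\<close>

lemma convolution_indicator:
  assumes "U \<subseteq> arrows G" "inj_on (gran G) U" "V \<subseteq> arrows G"
  shows "convolution G (indicator U) (indicator V) = (indicator (set_comp G U V) :: 'g \<Rightarrow> 'k::comm_ring_1)"
proof
  fix \<gamma>
  show "convolution G (indicator U) (indicator V) \<gamma> = (indicator (set_comp G U V) \<gamma> :: 'k)"
  proof (cases "\<gamma> \<in> arrows G")
    case True
    define S where "S = {\<alpha> \<in> arrows G. gran G \<alpha> = gran G \<gamma> \<and> (indicator U \<alpha> :: 'k) \<noteq> 0}"
    have "finite S" using row_finite_indicator[OF assms(2)] unfolding row_finite_def S_def by blast
    then have sum: "convolution G (indicator U) (indicator V) \<gamma> =
        (\<Sum>\<alpha>\<in>S. (indicator U \<alpha> :: 'k) * indicator V (gcomp G (ginv G \<alpha>) \<gamma>))"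
      by (intro convolution_eq_sum True) (auto simp: S_def)
    have S_iff: "\<alpha> \<in> S \<longleftrightarrow> \<alpha> \<in> U \<and> gran G \<alpha> = gran G \<gamma>" for \<alpha>
      using assms(1) by (auto simp: S_def indicator_def)
    show ?thesis
    proof (cases "S = {}")
      case True
      then have "\<gamma> \<notin> set_comp G U V"
        using S_iff by (fastforce simp: set_comp_def ran_comp)
      then show ?thesis using sum True by simp
    next
      case False
      then obtain \<alpha> where "\<alpha> \<in> S" by blast
      then have \<alpha>: "\<alpha> \<in> U" "gran G \<alpha> = gran G \<gamma>"
        using S_iff by blast+
      have "\<alpha>' = \<alpha>" if "\<alpha>' \<in> S" for \<alpha>'
        using that \<alpha> S_iff[of \<alpha>'] inj_onD[OF assms(2), of \<alpha>' \<alpha>] by simp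
      then have "S = {\<alpha>}" using \<open>\<alpha> \<in> S\<close> by blast
      note S = this \<alpha>
      have "\<gamma> \<in> set_comp G U V \<longleftrightarrow> gcomp G (ginv G \<alpha>) \<gamma> \<in> V"
      proof
        assume "\<gamma> \<in> set_comp G U V"
        then obtain \<alpha>' \<beta> where *: "\<alpha>' \<in> U" "\<beta> \<in> V" "(\<alpha>', \<beta>) \<in> composable G" "\<gamma> = gcomp G \<alpha>' \<beta>"
          by (auto simp: set_comp_def)
        then have "\<alpha>' = \<alpha>" using S assms(2) by (simp add: ran_comp inj_on_def)
        then show "gcomp G (ginv G \<alpha>) \<gamma> \<in> V" using * inv_comp_cancel by simp
      next
        assume "gcomp G (ginv G \<alpha>) \<gamma> \<in> V"
        then show "\<gamma> \<in> set_comp G U V"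
          using composable_inv_left[of \<alpha> \<gamma>] S \<open>\<gamma> \<in> arrows G\<close> assms(1)
          unfolding set_comp_def mem_Collect_eq by (metis subsetD)
      qed
      then show ?thesis using sum S by (simp add: indicator_def)
    qed
  next
    case False
    then have "\<gamma> \<notin> set_comp G U V" using set_comp_subset by blast
    then show ?thesis using False by (simp add: convolution_outside)
  qed
qed

end

section \<open>Topology of ranges, inverses and products of open sets\<close>

context topological_groupoid
begin

lemma continuous_map_gcomp:
  assumes "continuous_map X (gtop G) f" "continuous_map X (gtop G) g"
    and "\<And>x. x \<in> topspace X \<Longrightarrow> gdom G (f x) = gran G (g x)"
  shows "continuous_map X (gtop G) (\<lambda>x. gcomp G (f x) (g x))"
proof -
  have "f x \<in> arrows G" "g x \<in> arrows G" if "x \<in> topspace X" for x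
    using that assms(1,2) by (auto simp: continuous_map_def Pi_iff)
  then have "continuous_map X (subtopology (prod_topology (gtop G) (gtop G)) (composable G)) (\<lambda>x. (f x, g x))"
    using assms by (auto simp: continuous_map_in_subtopology continuous_map_paired composable_iff)
  from continuous_map_compose[OF this continuous_comp] show ?thesis
    by (simp add: o_def)
qed

lemma continuous_map_gdom: "continuous_map (gtop G) (unit_top G) (gdom G)"
proof -
  have "continuous_map (gtop G) (gtop G) (\<lambda>x. gcomp G (ginv G x) x)"
    by (rule continuous_map_gcomp) (auto simp: continuous_inv dom_inv)
  then show ?thesis
    unfolding unit_top_def continuous_map_in_subtopology
    by (auto simp: units_def gdom_def[abs_def])
qed

lemma continuous_map_gran: "continuous_map (gtop G) (unit_top G) (gran G)"
proof (rule continuous_map_eq)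
  show "continuous_map (gtop G) (unit_top G) (gdom G \<circ> ginv G)"
    using continuous_inv continuous_map_gdom by (rule continuous_map_compose)
qed (simp add: dom_inv)

lemma set_inv_eq_preimage:
  "U \<subseteq> arrows G \<Longrightarrow> set_inv G U = {\<gamma> \<in> arrows G. ginv G \<gamma> \<in> U}"
  using mem_set_inv set_inv_subset by blast

lemma openin_set_inv:
  assumes "openin (gtop G) U" shows "openin (gtop G) (set_inv G U)"
  using openin_continuous_map_preimage[OF continuous_inv assms] openin_subset[OF assms]
  by (simp add: set_inv_eq_preimage)

lemma gran_image_eq: "U \<subseteq> arrows G \<Longrightarrow> gran G ` U = gdom G ` set_inv G U"
  by (force simp: set_inv_def dom_inv)

lemma gdom_image_eq: "U \<subseteq> arrows G \<Longrightarrow> gdom G ` U = gran G ` set_inv G U"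
  by (force simp: set_inv_def ran_inv)

end

context etale_groupoid
begin

lemma openin_gdom_image:
  assumes U: "openin (gtop G) U" shows "openin (unit_top G) (gdom G ` U)"
proof (subst openin_subopen, intro ballI)
  fix y assume "y \<in> gdom G ` U"
  then obtain x where x: "x \<in> U" "y = gdom G x" by blast
  then have "x \<in> arrows G" using openin_subset[OF U] by blast
  then obtain W where W: "openin (gtop G) W" "x \<in> W" "openin (unit_top G) (gdom G ` W)"
    "homeomorphic_map (subtopology (gtop G) W) (subtopology (unit_top G) (gdom G ` W)) (gdom G)"
    using local_homeomorphism_dom unfolding local_homeomorphism_def by blast
  have "openin (subtopology (gtop G) W) (U \<inter> W)"
    using U by (auto simp: openin_subtopology)
  then have "openin (subtopology (unit_top G) (gdom G ` W)) (gdom G ` (U \<inter> W))"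
    using homeomorphic_imp_open_map[OF W(4)] by (simp add: open_map_def)
  then have "openin (unit_top G) (gdom G ` (U \<inter> W))"
    using W(3) by (rule openin_trans_full)
  then show "\<exists>T. openin (unit_top G) T \<and> y \<in> T \<and> T \<subseteq> gdom G ` U"
    using x W(2) by blast
qed

lemma openin_gran_image:
  assumes U: "openin (gtop G) U" shows "openin (unit_top G) (gran G ` U)"
  using openin_gdom_image[OF openin_set_inv[OF U]] openin_subset[OF U] by (simp add: gran_image_eq)

text \<open>The range map is open, hence its inverse on a set where it is injective is
  continuous.\<close>

lemma continuous_map_section:
  assumes U: "openin (gtop G) U" and inj: "inj_on (gran G) U"
  shows "continuous_map (subtopology (unit_top G) (gran G ` U)) (gtop G) (inv_into U (gran G))"
  unfolding continuous_map_def
proof (intro conjI allI impI)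
  have sub: "U \<subseteq> arrows G" using openin_subset[OF U] .
  have ts: "topspace (subtopology (unit_top G) (gran G ` U)) = gran G ` U"
    using sub ran_in_units by (auto simp: topspace_unit_top)
  show "inv_into U (gran G) \<in> topspace (subtopology (unit_top G) (gran G ` U)) \<rightarrow> arrows G"
    unfolding ts using sub inj by auto
  fix W assume W: "openin (gtop G) W"
  have "{x \<in> gran G ` U. inv_into U (gran G) x \<in> W} = gran G ` (U \<inter> W)"
    using inj by auto
  moreover have "openin (subtopology (unit_top G) (gran G ` U)) (gran G ` (U \<inter> W))"
    using openin_gran_image[OF openin_Int[OF U W]] unfolding openin_subtopology by blast
  ultimately show "openin (subtopology (unit_top G) (gran G ` U))
      {x \<in> topspace (subtopology (unit_top G) (gran G ` U)). inv_into U (gran G) x \<in> W}"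
    unfolding ts by simp
qed

lemma openin_set_comp:
  assumes U: "openin (gtop G) U" "inj_on (gran G) U" and V: "openin (gtop G) V"
  shows "openin (gtop G) (set_comp G U V)"
proof -
  define s where "s = inv_into U (gran G)"
  define D where "D = {\<gamma> \<in> arrows G. gran G \<gamma> \<in> gran G ` U}"
  define X where "X = subtopology (gtop G) D"
  have sub: "U \<subseteq> arrows G" "V \<subseteq> arrows G" using openin_subset U V by blast+
  have D: "openin (gtop G) D"
    unfolding D_def by (rule openin_continuous_map_preimage[OF continuous_map_gran openin_gran_image[OF U(1)]])
  have tX: "topspace X = D" by (auto simp: X_def D_def)
  have s: "s (gran G \<gamma>) \<in> U" "gran G (s (gran G \<gamma>)) = gran G \<gamma>" if "\<gamma> \<in> D" for \<gamma>
    using that unfolding D_def s_def by (auto intro: inv_into_into f_inv_into_f)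
  have "continuous_map X (subtopology (unit_top G) (gran G ` U)) (gran G)"
    unfolding X_def using continuous_map_gran
    by (auto simp: continuous_map_in_subtopology D_def intro: continuous_map_from_subtopology)
  from continuous_map_compose[OF this continuous_map_section[OF U]]
  have cs: "continuous_map X (gtop G) (\<lambda>\<gamma>. s (gran G \<gamma>))"
    by (simp add: s_def o_def)
  have "continuous_map X (gtop G) (\<lambda>\<gamma>. gcomp G (ginv G (s (gran G \<gamma>))) \<gamma>)"
  proof (rule continuous_map_gcomp)
    show "continuous_map X (gtop G) (\<lambda>\<gamma>. ginv G (s (gran G \<gamma>)))"
      using continuous_map_compose[OF cs continuous_inv] by (simp add: o_def)
    show "continuous_map X (gtop G) (\<lambda>\<gamma>. \<gamma>)"
      unfolding X_def by (simp add: continuous_map_from_subtopology)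
    show "gdom G (ginv G (s (gran G x))) = gran G x" if "x \<in> topspace X" for x
      using that sub s by (auto simp: tX dom_inv subset_iff)
  qed
  from openin_continuous_map_preimage[OF this V]
  have "openin (gtop G) {\<gamma> \<in> D. gcomp G (ginv G (s (gran G \<gamma>))) \<gamma> \<in> V}"
    unfolding tX unfolding X_def using D openin_trans_full by blast
  moreover have "{\<gamma> \<in> D. gcomp G (ginv G (s (gran G \<gamma>))) \<gamma> \<in> V} = set_comp G U V"
  proof (intro equalityI subsetI)
    fix \<gamma> assume \<gamma>: "\<gamma> \<in> {\<gamma> \<in> D. gcomp G (ginv G (s (gran G \<gamma>))) \<gamma> \<in> V}"
    then have "s (gran G \<gamma>) \<in> arrows G" "\<gamma> \<in> arrows G" "gran G (s (gran G \<gamma>)) = gran G \<gamma>"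
      using s sub by (auto simp: D_def)
    from composable_inv_left[OF this] show "\<gamma> \<in> set_comp G U V"
      using \<gamma> s(1) unfolding set_comp_def by force
  next
    fix \<gamma> assume "\<gamma> \<in> set_comp G U V"
    then obtain \<alpha> \<beta> where *: "\<alpha> \<in> U" "\<beta> \<in> V" "(\<alpha>, \<beta>) \<in> composable G" "\<gamma> = gcomp G \<alpha> \<beta>"
      by (auto simp: set_comp_def)
    then have "gran G \<gamma> = gran G \<alpha>" "\<gamma> \<in> D" by (auto simp: ran_comp D_def comp_closed)
    moreover have "s (gran G \<alpha>) = \<alpha>" using *(1) U(2) by (simp add: s_def)
    ultimately show "\<gamma> \<in> {\<gamma> \<in> D. gcomp G (ginv G (s (gran G \<gamma>))) \<gamma> \<in> V}"
      using * inv_comp_cancel by simp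
  qed
  ultimately show ?thesis by simp
qed

end

lemma open_bisectionsD:
  assumes "U \<in> open_bisections G"
  shows "openin (gtop G) U" "inj_on (gdom G) U" "inj_on (gran G) U" "U \<subseteq> arrows G"
  using assms openin_subset[of "gtop G" U] by (auto simp: open_bisections_def)

lemma compact_open_bisectionsD:
  assumes "U \<in> compact_open_bisections G"
  shows "U \<in> open_bisections G" "compactin (gtop G) U"
  using assms by (auto simp: compact_open_bisections_def)

context groupoid
begin

lemma inj_on_set_inv:
  assumes "U \<subseteq> arrows G"
  shows "inj_on (gdom G) U \<Longrightarrow> inj_on (gran G) (set_inv G U)"
    "inj_on (gran G) U \<Longrightarrow> inj_on (gdom G) (set_inv G U)"
  using assms by (auto simp: set_inv_def inj_on_def dom_inv ran_inv subset_iff)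

lemma inj_on_set_comp:
  shows "inj_on (gran G) U \<Longrightarrow> inj_on (gran G) V \<Longrightarrow> inj_on (gran G) (set_comp G U V)"
    "inj_on (gdom G) U \<Longrightarrow> inj_on (gdom G) V \<Longrightarrow> inj_on (gdom G) (set_comp G U V)"
proof -
  show "inj_on (gran G) (set_comp G U V)" if "inj_on (gran G) U" "inj_on (gran G) V"
  proof (rule inj_onI)
    fix x y assume "x \<in> set_comp G U V" "y \<in> set_comp G U V" and xy: "gran G x = gran G y"
    then obtain \<alpha> \<beta> \<alpha>' \<beta>' where *: "\<alpha> \<in> U" "\<beta> \<in> V" "(\<alpha>, \<beta>) \<in> composable G" "x = gcomp G \<alpha> \<beta>"
      "\<alpha>' \<in> U" "\<beta>' \<in> V" "(\<alpha>', \<beta>') \<in> composable G" "y = gcomp G \<alpha>' \<beta>'"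
      unfolding set_comp_def by blast
    then have "\<alpha> = \<alpha>'" using that(1) xy by (simp add: ran_comp inj_on_def)
    moreover from this have "\<beta> = \<beta>'" using that(2) * by (simp add: composable_iff inj_on_def)
    ultimately show "x = y" using * by simp
  qed
  show "inj_on (gdom G) (set_comp G U V)" if "inj_on (gdom G) U" "inj_on (gdom G) V"
  proof (rule inj_onI)
    fix x y assume "x \<in> set_comp G U V" "y \<in> set_comp G U V" and xy: "gdom G x = gdom G y"
    then obtain \<alpha> \<beta> \<alpha>' \<beta>' where *: "\<alpha> \<in> U" "\<beta> \<in> V" "(\<alpha>, \<beta>) \<in> composable G" "x = gcomp G \<alpha> \<beta>"
      "\<alpha>' \<in> U" "\<beta>' \<in> V" "(\<alpha>', \<beta>') \<in> composable G" "y = gcomp G \<alpha>' \<beta>'"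
      unfolding set_comp_def by blast
    then have "\<beta> = \<beta>'" using that(2) xy by (simp add: dom_comp inj_on_def)
    moreover from this have "\<alpha> = \<alpha>'" using that(1) * by (simp add: composable_iff inj_on_def)
    ultimately show "x = y" using * by simp
  qed
qed

end

context ample_groupoid
begin

lemma set_inv_open_bisections:
  assumes "U \<in> open_bisections G" shows "set_inv G U \<in> open_bisections G"
  using open_bisectionsD[OF assms] by (simp add: open_bisections_def openin_set_inv inj_on_set_inv)

lemma set_inv_compact_open_bisections:
  assumes "U \<in> compact_open_bisections G" shows "set_inv G U \<in> compact_open_bisections G"
  using compact_open_bisectionsD[OF assms] image_compactin[OF _ continuous_inv, of U]
  by (simp add: compact_open_bisections_def set_inv_open_bisections) (simp add: set_inv_def)

text \<open>The composable pairs are closed in the product because the unit space is Hausdorff, even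
  if the groupoid is not; so the relevant part of U \<times> V is compact.\<close>

lemma compactin_set_comp:
  assumes "compactin (gtop G) U" "compactin (gtop G) V"
  shows "compactin (gtop G) (set_comp G U V)"
proof -
  let ?P = "prod_topology (gtop G) (gtop G)"
  have "closedin ?P {z \<in> topspace ?P. gdom G (fst z) = gran G (snd z)}"
  proof (rule closedin_continuous_maps_eq[OF Hausdorff_units])
    show "continuous_map ?P (unit_top G) (\<lambda>z. gdom G (fst z))"
      using continuous_map_compose[OF continuous_map_fst continuous_map_gdom] by (simp add: o_def)
    show "continuous_map ?P (unit_top G) (\<lambda>z. gran G (snd z))"
      using continuous_map_compose[OF continuous_map_snd continuous_map_gran] by (simp add: o_def)
  qed
  moreover have "{z \<in> topspace ?P. gdom G (fst z) = gran G (snd z)} = composable G"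
    by (auto simp: composable_def)
  ultimately have "compactin ?P (composable G \<inter> (U \<times> V))"
    using assms by (intro closed_Int_compactin) (auto simp: compactin_Times)
  then have "compactin (subtopology ?P (composable G)) (composable G \<inter> (U \<times> V))"
    by (simp add: compactin_subtopology)
  from image_compactin[OF this continuous_comp]
  have "compactin (gtop G) ((\<lambda>(\<alpha>, \<beta>). gcomp G \<alpha> \<beta>) ` (composable G \<inter> (U \<times> V)))" .
  moreover have "(\<lambda>(\<alpha>, \<beta>). gcomp G \<alpha> \<beta>) ` (composable G \<inter> (U \<times> V)) = set_comp G U V"
    by (auto simp: set_comp_def image_iff)
  ultimately show ?thesis by simp
qed

lemma set_comp_compact_open_bisections:
  assumes "U \<in> compact_open_bisections G" "V \<in> compact_open_bisections G"
  shows "set_comp G U V \<in> compact_open_bisections G"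
  using compact_open_bisectionsD[OF assms(1)] compact_open_bisectionsD[OF assms(2)]
  by (auto simp: compact_open_bisections_def open_bisections_def
      intro!: openin_set_comp compactin_set_comp inj_on_set_comp)

section \<open>The span of indicators of compact open bisections (the Steinberg algebra)\<close>

definition step_functions :: "('a \<Rightarrow> 'k::comm_ring_1) set" where
  "step_functions = carrier (groupoid_algebra G)"

lemma step_functions_eq:
  "step_functions = {\<lambda>\<gamma>. \<Sum>U\<in>F. c U * indicator U \<gamma> |F c. finite F \<and> F \<subseteq> compact_open_bisections G}"
  by (simp add: step_functions_def groupoid_algebra_def)

lemma step_functions_0: "0 \<in> step_functions"
  unfolding step_functions_eq by (auto simp: fun_eq_iff intro!: exI[of _ "{}"])

text \<open>Nested uses, one per argument, reduce every multilinear identity to indicators, that is,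
  to an identity between sets of arrows.\<close>

lemma step_functions_induct [consumes 1, case_names zero add]:
  assumes "f \<in> step_functions"
    and zero: "P 0"
    and add: "\<And>c U f. \<lbrakk>U \<in> compact_open_bisections G; f \<in> step_functions; P f\<rbrakk> \<Longrightarrow> P ((\<lambda>\<gamma>. c * indicator U \<gamma>) + f)"
  shows "P f"
proof -
  obtain F c where F: "finite F" "F \<subseteq> compact_open_bisections G"
    and f: "f = (\<lambda>\<gamma>. \<Sum>U\<in>F. c U * indicator U \<gamma>)"
    using assms(1) unfolding step_functions_eq by blast
  have "P (\<lambda>\<gamma>. \<Sum>U\<in>F. c U * indicator U \<gamma>)"
    using F
  proof (induction F)
    case empty
    then show ?case using zero by (simp add: zero_fun_def)
  next
    case (insert U F)
    then have "(\<lambda>\<gamma>. \<Sum>U\<in>F. c U * indicator U \<gamma>) \<in> step_functions"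
      unfolding step_functions_eq by blast
    from add[OF _ this, of U "c U"] insert have "P ((\<lambda>\<gamma>. c U * indicator U \<gamma>) + (\<lambda>\<gamma>. \<Sum>U\<in>F. c U * indicator U \<gamma>))"
      by blast
    then show ?case using insert(1,2) by (simp only: plus_fun_def sum.insert not_False_eq_True)
  qed
  then show ?thesis by (simp add: f)
qed

lemma step_functions_add_indicator:
  assumes U: "U \<in> compact_open_bisections G" and "f \<in> step_functions"
  shows "(\<lambda>\<gamma>. a * indicator U \<gamma>) + f \<in> step_functions"
proof -
  obtain F c where F: "finite F" "F \<subseteq> compact_open_bisections G"
    and f: "f = (\<lambda>\<gamma>. \<Sum>U\<in>F. c U * indicator U \<gamma>)"
    using assms(2) unfolding step_functions_eq by blast
  \<comment> \<open>Coefficients are indexed by sets, so a U already present in F has to merge its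
    two coefficients.\<close>
  define c' where "c' V = (if V \<in> F then c V else 0) + (if V = U then a else 0)" for V
  have "(\<lambda>\<gamma>. a * indicator U \<gamma>) + f = (\<lambda>\<gamma>. \<Sum>V\<in>insert U F. c' V * indicator V \<gamma>)"
  proof
    fix \<gamma>
    have "(\<Sum>V\<in>insert U F. c' V * indicator V \<gamma>) =
        (\<Sum>V\<in>insert U F. (if V \<in> F then c V else 0) * indicator V \<gamma>) +
        (\<Sum>V\<in>insert U F. (if V = U then a else 0) * indicator V \<gamma>)"
      by (simp only: c'_def distrib_right sum.distrib)
    also have "(\<Sum>V\<in>insert U F. (if V \<in> F then c V else 0) * indicator V \<gamma>) = f \<gamma>"
      unfolding f using F(1) by (intro sum.mono_neutral_cong_right) auto
    also have "(\<Sum>V\<in>insert U F. (if V = U then a else 0) * indicator V \<gamma>) = a * indicator U \<gamma>"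
      using F(1) by (simp add: if_distrib[of "\<lambda>x. x * _"] sum.delta cong: if_cong)
    finally show "((\<lambda>\<gamma>. a * indicator U \<gamma>) + f) \<gamma> = (\<Sum>V\<in>insert U F. c' V * indicator V \<gamma>)"
      by (simp add: add.commute)
  qed
  then show ?thesis unfolding step_functions_eq using F U by blast
qed

lemma step_functions_indicator:
  "U \<in> compact_open_bisections G \<Longrightarrow> (\<lambda>\<gamma>. a * indicator U \<gamma>) \<in> step_functions"
  using step_functions_add_indicator[OF _ step_functions_0] by simp

lemma step_functions_add: "f \<in> step_functions \<Longrightarrow> g \<in> step_functions \<Longrightarrow> f + g \<in> step_functions"
  by (induction f rule: step_functions_induct) (auto simp: add.assoc step_functions_add_indicator)

lemma step_functions_sum: "(\<And>i. i \<in> I \<Longrightarrow> f i \<in> step_functions) \<Longrightarrow> sum f I \<in> step_functions"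
  by (induction I rule: infinite_finite_induct)
     (simp_all only: sum.infinite sum.empty sum.insert step_functions_0 step_functions_add insert_iff simp_thms)

lemma step_functions_smult:
  assumes "f \<in> step_functions" shows "(\<lambda>\<gamma>. b * f \<gamma>) \<in> step_functions"
  using assms
proof (induction f rule: step_functions_induct)
  case zero
  then show ?case using step_functions_0 by (simp add: zero_fun_def)
next
  case (add c U f)
  have "(\<lambda>\<gamma>. b * ((\<lambda>\<gamma>. c * indicator U \<gamma>) + f) \<gamma>) = (\<lambda>\<gamma>. (b * c) * indicator U \<gamma>) + (\<lambda>\<gamma>. b * f \<gamma>)"
    by (auto simp: fun_eq_iff algebra_simps)
  then show ?case using step_functions_add_indicator add by metis
qed

lemma step_functions_outside:
  assumes "f \<in> step_functions" "\<gamma> \<notin> arrows G" shows "f \<gamma> = 0"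
  using assms
  by (induction f rule: step_functions_induct)
     (auto simp: indicator_def dest: compact_open_bisectionsD open_bisectionsD(4))

lemma row_finite_step_function: "f \<in> step_functions \<Longrightarrow> row_finite f"
proof (induction f rule: step_functions_induct)
  case zero
  then show ?case by (simp add: row_finite_def)
next
  case (add c U f)
  then show ?case
    by (intro row_finite_add row_finite_smult row_finite_indicator)
       (auto dest: compact_open_bisectionsD open_bisectionsD)
qed

lemma convolution_smult_indicator:
  assumes "U \<in> compact_open_bisections G" "V \<in> compact_open_bisections G"
  shows "convolution G (\<lambda>\<gamma>. a * indicator U \<gamma>) (\<lambda>\<gamma>. b * indicator V \<gamma>) =
    (\<lambda>\<gamma>. a * b * indicator (set_comp G U V) \<gamma>)"
  using assms[THEN compact_open_bisectionsD(1), THEN open_bisectionsD(4)]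
    assms(1)[THEN compact_open_bisectionsD(1), THEN open_bisectionsD(3)]
  by (simp add: convolution_smult row_finite_indicator convolution_indicator)

lemma convolution_0: "convolution G 0 f = 0" "convolution G f 0 = 0"
  by (simp_all add: convolution_def fun_eq_iff)

lemma convolution_step_add_left:
  "\<lbrakk>f \<in> step_functions; g \<in> step_functions\<rbrakk> \<Longrightarrow> convolution G (f + g) h = convolution G f h + convolution G g h"
  by (simp add: convolution_add_left row_finite_step_function)

lemma convolution_step_add_right:
  "f \<in> step_functions \<Longrightarrow> convolution G f (g + h) = convolution G f g + convolution G f h"
  by (simp add: convolution_add_right row_finite_step_function)

lemma convolution_closed:
  assumes "f \<in> step_functions" "g \<in> step_functions"
  shows "convolution G f g \<in> step_functions"
  using assms
proof (induction f rule: step_functions_induct)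
  case zero
  show ?case unfolding convolution_0 by (rule step_functions_0)
next
  case (add a U f)
  have "convolution G (\<lambda>\<gamma>. a * indicator U \<gamma>) g \<in> step_functions"
    using \<open>g \<in> step_functions\<close>
  proof (induction g rule: step_functions_induct)
    case zero
    show ?case unfolding convolution_0 by (rule step_functions_0)
  next
    case (add b V g)
    then show ?case
      using \<open>U \<in> _\<close> by (simp add: convolution_step_add_right step_functions_indicator step_functions_add
          convolution_smult_indicator set_comp_compact_open_bisections del: plus_fun_apply)
  qed
  then show ?case
    using add by (simp add: convolution_step_add_left step_functions_indicator step_functions_add
        del: plus_fun_apply)
qed

lemma convolution_assoc:
  assumes "f \<in> step_functions" "g \<in> step_functions" "h \<in> step_functions"
  shows "convolution G (convolution G f g) h = convolution G f (convolution G g h)"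
  using assms
proof (induction f rule: step_functions_induct)
  case zero
  then show ?case by (simp only: convolution_0)
next
  case (add a U f)
  note U = \<open>U \<in> compact_open_bisections G\<close> and h = \<open>h \<in> step_functions\<close>
  have "convolution G (convolution G (\<lambda>\<gamma>. a * indicator U \<gamma>) g) h =
      convolution G (\<lambda>\<gamma>. a * indicator U \<gamma>) (convolution G g h)"
    using \<open>g \<in> step_functions\<close>
  proof (induction g rule: step_functions_induct)
    case zero
    then show ?case by (simp only: convolution_0)
  next
    case (add b V g)
    note V = \<open>V \<in> compact_open_bisections G\<close>
    have "convolution G (convolution G (\<lambda>\<gamma>. a * indicator U \<gamma>) (\<lambda>\<gamma>. b * indicator V \<gamma>)) h =
        convolution G (\<lambda>\<gamma>. a * indicator U \<gamma>) (convolution G (\<lambda>\<gamma>. b * indicator V \<gamma>) h)"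
      using h
    proof (induction h rule: step_functions_induct)
      case zero
      then show ?case by (simp only: convolution_0)
    next
      case (add c W h)
      have "set_comp G (set_comp G U V) W = set_comp G U (set_comp G V W)"
        using U V add(1) by (intro set_comp_assoc) (auto dest!: compact_open_bisectionsD(1) open_bisectionsD(4))
      then show ?case
        using U V add by (simp add: convolution_step_add_right step_functions_indicator convolution_closed
            convolution_smult_indicator set_comp_compact_open_bisections del: plus_fun_apply)
          (simp add: mult.assoc)
    qed
    then show ?case
      using U V h add by (simp add: convolution_step_add_right convolution_step_add_left
          step_functions_indicator convolution_closed del: plus_fun_apply)
  qed
  then show ?case
    using U h add by (simp add: convolution_step_add_left step_functions_indicator convolution_closed
        del: plus_fun_apply)
qed

end

section \<open>The trace of an invariant measure\<close>

context ample_groupoid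
begin

text \<open>The value off the arrows is forced to 0, since \<open>ginv\<close> is arbitrary there
  while elements of the algebra vanish.\<close>

definition adjoint :: "('a \<Rightarrow> complex) \<Rightarrow> 'a \<Rightarrow> complex" where
  "adjoint f = (\<lambda>\<gamma>. if \<gamma> \<in> arrows G then cnj (f (ginv G \<gamma>)) else 0)"

lemma adjoint_0: "adjoint 0 = 0"
  by (simp add: adjoint_def fun_eq_iff)

lemma adjoint_add: "adjoint (f + g) = adjoint f + adjoint g"
  by (simp add: adjoint_def fun_eq_iff)

lemma adjoint_indicator:
  assumes "U \<in> compact_open_bisections G"
  shows "adjoint (\<lambda>\<gamma>. c * indicator U \<gamma>) = (\<lambda>\<gamma>. cnj c * indicator (set_inv G U) \<gamma>)"
  using open_bisectionsD(4)[OF compact_open_bisectionsD(1)[OF assms]]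
  by (auto simp: adjoint_def fun_eq_iff indicator_def set_inv_eq_preimage)

lemma adjoint_closed: "f \<in> step_functions \<Longrightarrow> adjoint f \<in> step_functions"
proof (induction f rule: step_functions_induct)
  case zero
  show ?case unfolding adjoint_0 by (rule step_functions_0)
next
  case (add c U f)
  then show ?case
    unfolding adjoint_add
    by (intro step_functions_add) (simp_all add: adjoint_indicator step_functions_indicator set_inv_compact_open_bisections)
qed

lemma adjoint_adjoint: "f \<in> step_functions \<Longrightarrow> adjoint (adjoint f) = f"
  by (auto simp: adjoint_def fun_eq_iff inv_closed inv_inv step_functions_outside)

lemma adjoint_convolution:
  assumes "f \<in> step_functions" "g \<in> step_functions"
  shows "adjoint (convolution G f g) = convolution G (adjoint g) (adjoint f)"
  using assms
proof (induction f rule: step_functions_induct)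
  case zero
  show ?case by (simp only: convolution_0 adjoint_0)
next
  case (add a U f)
  have "adjoint (convolution G (\<lambda>\<gamma>. a * indicator U \<gamma>) g) =
      convolution G (adjoint g) (adjoint (\<lambda>\<gamma>. a * indicator U \<gamma>))"
    using \<open>g \<in> step_functions\<close>
  proof (induction g rule: step_functions_induct)
    case zero
    show ?case by (simp only: convolution_0 adjoint_0)
  next
    case (add b V g)
    have "set_inv G (set_comp G U V) = set_comp G (set_inv G V) (set_inv G U)"
      using add(1) \<open>U \<in> _\<close> by (intro set_inv_comp) (auto dest!: compact_open_bisectionsD(1) open_bisectionsD(4))
    then have "adjoint (convolution G (\<lambda>\<gamma>. a * indicator U \<gamma>) (\<lambda>\<gamma>. b * indicator V \<gamma>)) =
        convolution G (adjoint (\<lambda>\<gamma>. b * indicator V \<gamma>)) (adjoint (\<lambda>\<gamma>. a * indicator U \<gamma>))"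
      using add(1) \<open>U \<in> _\<close>
      by (simp add: convolution_smult_indicator adjoint_indicator set_comp_compact_open_bisections
          set_inv_compact_open_bisections) (simp add: mult_ac)
    then show ?case
      using add \<open>U \<in> _\<close>
      by (simp add: convolution_step_add_right convolution_step_add_left step_functions_indicator
          adjoint_add adjoint_closed del: plus_fun_apply)
  qed
  then show ?case
    using add by (simp add: convolution_step_add_left convolution_step_add_right step_functions_indicator
        adjoint_add adjoint_closed del: plus_fun_apply)
qed

section \<open>Products of bisections seen in the unit space\<close>

lemma set_comp_units:
  assumes "X \<subseteq> units G" shows "set_comp G X X = X"
proof (intro equalityI subsetI)
  have xx: "gcomp G x x = x" "(x, x) \<in> composable G" if "x \<in> X" for x
    using that assms comp_dom[of x] unitsD[of x] by (auto simp: composable_iff)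
  show "x \<in> set_comp G X X" if "x \<in> X" for x
    unfolding set_comp_def using xx[OF that] that by force
  fix z assume "z \<in> set_comp G X X"
  then obtain x y where z: "z = gcomp G x y" "x \<in> X" "y \<in> X" "(x, y) \<in> composable G"
    by (auto simp: set_comp_def)
  then have "x = y" using unitsD(2)[of x] unitsD(3)[of y] assms by (auto simp: composable_iff)
  then show "z \<in> X" using z xx by simp
qed

lemma set_inv_units: "X \<subseteq> units G \<Longrightarrow> set_inv G X = X"
  by (simp add: set_inv_def inv_unit subset_iff cong: image_cong_simp)

text \<open>A product \<alpha>\<beta> is a unit only if \<beta> is the inverse of \<alpha>, and then
  it equals the range of \<alpha>. This computes the trace of a product of two indicators.\<close>

lemma set_comp_Int_units:
  assumes "U \<subseteq> arrows G" "V \<subseteq> arrows G"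
  shows "set_comp G U V \<inter> units G = gran G ` (U \<inter> set_inv G V)"
proof (intro equalityI subsetI)
  fix x assume "x \<in> set_comp G U V \<inter> units G"
  then obtain \<alpha> \<beta> where *: "\<alpha> \<in> U" "\<beta> \<in> V" "(\<alpha>, \<beta>) \<in> composable G" "x = gcomp G \<alpha> \<beta>" "x \<in> units G"
    by (auto simp: set_comp_def)
  then have x: "x = gran G \<alpha>" using unitsD(3)[of x] ran_comp[OF *(3)] by simp
  then have "\<beta> = ginv G \<alpha>" using * by (intro inv_unique) auto
  then have "\<alpha> \<in> set_inv G V" using * assms by (simp add: mem_set_inv composable_iff)
  then show "x \<in> gran G ` (U \<inter> set_inv G V)" using x * by blast
next
  fix x assume "x \<in> gran G ` (U \<inter> set_inv G V)"
  then obtain \<alpha> where \<alpha>: "\<alpha> \<in> U" "\<alpha> \<in> set_inv G V" "x = gran G \<alpha>" by blast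
  then have "\<alpha> \<in> arrows G" "ginv G \<alpha> \<in> V" using assms by (auto simp: mem_set_inv)
  moreover from this have "(\<alpha>, ginv G \<alpha>) \<in> composable G" by (simp add: composable_iff inv_closed ran_inv)
  moreover have "x = gcomp G \<alpha> (ginv G \<alpha>)" using \<alpha> by (simp add: gran_def)
  ultimately have "x \<in> set_comp G U V" unfolding set_comp_def using \<alpha>(1) by blast
  then show "x \<in> set_comp G U V \<inter> units G"
    using \<alpha>(3) ran_in_units[OF \<open>\<alpha> \<in> arrows G\<close>] by blast
qed

lemma set_comp_set_inv_self:
  assumes "U \<in> open_bisections G"
  shows "set_comp G U (set_inv G U) = gran G ` U" "set_comp G (set_inv G U) U = gdom G ` U"
proof -
  have gran: "set_comp G U (set_inv G U) = gran G ` U" if U: "U \<in> open_bisections G" for U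
  proof (intro equalityI subsetI)
    note U = open_bisectionsD[OF U]
    fix x assume "x \<in> set_comp G U (set_inv G U)"
    then obtain \<alpha> \<beta> where *: "\<alpha> \<in> U" "\<beta> \<in> U" "(\<alpha>, ginv G \<beta>) \<in> composable G" "x = gcomp G \<alpha> (ginv G \<beta>)"
      by (auto simp: set_comp_def set_inv_def)
    then have "gdom G \<alpha> = gdom G \<beta>" using U(4) by (auto simp: composable_iff ran_inv)
    then have "\<alpha> = \<beta>" using * U(2) by (simp add: inj_on_def)
    then show "x \<in> gran G ` U" using * by (auto simp: gran_def)
  next
    note U = open_bisectionsD[OF U]
    fix x assume "x \<in> gran G ` U"
    then obtain \<alpha> where "\<alpha> \<in> U" "x = gran G \<alpha>" by blast
    moreover from this have "(\<alpha>, ginv G \<alpha>) \<in> composable G"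
      using U(4) by (auto simp: composable_iff inv_closed ran_inv)
    ultimately show "x \<in> set_comp G U (set_inv G U)"
      by (auto simp: set_comp_def set_inv_def gran_def)
  qed
  show "set_comp G U (set_inv G U) = gran G ` U" using assms by (rule gran)
  show "set_comp G (set_inv G U) U = gdom G ` U"
    using gran[OF set_inv_open_bisections[OF assms]] open_bisectionsD(4)[OF assms]
    by (simp add: set_inv_set_inv gdom_image_eq)
qed

section \<open>Integration against an invariant measure\<close>

context
  fixes M :: "'a measure"
  assumes M: "invariant_measure G M"
begin

lemma space_M: "space M = units G"
  using M by (auto simp: invariant_measure_def radon_measure_def topspace_unit_top)

lemma sets_M: "openin (unit_top G) U \<Longrightarrow> U \<in> sets M"
  using M by (auto simp: invariant_measure_def radon_measure_def)

lemma emeasure_gran_eq_gdom: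
  "U \<in> open_bisections G \<Longrightarrow> emeasure M (gran G ` U) = emeasure M (gdom G ` U)"
  using M by (auto simp: invariant_measure_def set_comp_set_inv_self)

lemma Int_units_in_sets: "U \<in> compact_open_bisections G \<Longrightarrow> U \<inter> units G \<in> sets M"
  by (intro sets_M) (auto simp: unit_top_def openin_subtopology dest: compact_open_bisectionsD open_bisectionsD(1))

lemma emeasure_Int_units_finite:
  assumes U: "U \<in> compact_open_bisections G" shows "emeasure M (U \<inter> units G) < \<infinity>"
proof -
  note U' = compact_open_bisectionsD[OF U]
  have "U \<inter> units G \<subseteq> gran G ` U" using unitsD(3) by force
  then have "emeasure M (U \<inter> units G) \<le> emeasure M (gran G ` U)"
    using U' by (intro emeasure_mono sets_M openin_gran_image) (auto dest: open_bisectionsD)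
  also have "compactin (unit_top G) (gran G ` U)"
    using image_compactin[OF U'(2) continuous_map_gran] .
  then have "emeasure M (gran G ` U) < \<infinity>"
    using M by (auto simp: invariant_measure_def radon_measure_def)
  finally show ?thesis .
qed

lemma integrable_indicator_bisection:
  "U \<in> compact_open_bisections G \<Longrightarrow> integrable M (indicator U :: 'a \<Rightarrow> real)"
  using Int_units_in_sets[of U] emeasure_Int_units_finite[of U]
  by (simp add: integrable_indicator_iff space_M)

text \<open>Only the values of f on units enter, as the measure lives there. The real part alone is
  kept, to match the real-valued traces of the abstract algebra.\<close>

definition trace :: "('a \<Rightarrow> complex) \<Rightarrow> real" where
  "trace f = (LINT x|M. Re (f x))"

lemma Re_smult_indicator: "Re (c * indicator U x) = Re c * indicator U x"
  by (simp add: indicator_def)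

lemma integrable_Re: "f \<in> step_functions \<Longrightarrow> integrable M (\<lambda>x. Re (f x))"
proof (induction f rule: step_functions_induct)
  case (add c U f)
  then show ?case
    unfolding plus_fun_apply plus_complex.sel Re_smult_indicator
    by (intro Bochner_Integration.integrable_add integrable_mult_right integrable_indicator_bisection)
qed simp

lemma trace_add: "\<lbrakk>f \<in> step_functions; g \<in> step_functions\<rbrakk> \<Longrightarrow> trace (f + g) = trace f + trace g"
  by (simp add: trace_def integrable_Re)

lemma trace_scaleR: "trace (r *\<^sub>R f) = r * trace f"
  by (simp add: trace_def)

lemma trace_smult_indicator: "trace (\<lambda>\<gamma>. c * indicator U \<gamma>) = Re c * measure M (U \<inter> units G)"
  unfolding trace_def Re_smult_indicator by (simp add: space_M)

lemma trace_convolution_commute: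
  assumes "f \<in> step_functions" "g \<in> step_functions"
  shows "trace (convolution G f g) = trace (convolution G g f)"
  using assms
proof (induction f rule: step_functions_induct)
  case zero
  show ?case by (simp only: convolution_0)
next
  case (add a U f)
  have "trace (convolution G (\<lambda>\<gamma>. a * indicator U \<gamma>) g) = trace (convolution G g (\<lambda>\<gamma>. a * indicator U \<gamma>))"
    using \<open>g \<in> step_functions\<close>
  proof (induction g rule: step_functions_induct)
    case zero
    show ?case by (simp only: convolution_0)
  next
    case (add b V g)
    note UV = \<open>U \<in> compact_open_bisections G\<close> \<open>V \<in> compact_open_bisections G\<close>
    note sub = UV[THEN compact_open_bisectionsD(1), THEN open_bisectionsD(4)]
    \<comment> \<open>The traces of the two products are governed by the measures of the range and
      of the domain of W. As W need not be compact, invariance is applied to it as an open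
      bisection.\<close>
    let ?W = "U \<inter> set_inv G V"
    have W: "?W \<in> open_bisections G"
      using UV[THEN compact_open_bisectionsD(1)] set_inv_open_bisections[of V]
      by (auto simp: open_bisections_def intro: inj_on_subset)
    have "?W \<subseteq> arrows G" using sub by blast
    then have "set_inv G ?W = V \<inter> set_inv G U"
      using sub by (auto simp: set_inv_eq_preimage inv_closed inv_inv)
    then have "gdom G ` ?W = gran G ` (V \<inter> set_inv G U)"
      using gdom_image_eq[of ?W] sub by (simp add: le_infI1)
    then have "measure M (set_comp G U V \<inter> units G) = measure M (set_comp G V U \<inter> units G)"
      using emeasure_gran_eq_gdom[OF W] sub by (simp add: set_comp_Int_units measure_def)
    then show ?case
      using add UV
      by (simp add: convolution_step_add_right convolution_step_add_left step_functions_indicator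
          convolution_closed trace_add convolution_smult_indicator trace_smult_indicator mult.commute
          set_comp_compact_open_bisections
          del: plus_fun_apply)
  qed
  then show ?case
    using add
    by (simp add: convolution_step_add_right convolution_step_add_left step_functions_indicator
        convolution_closed trace_add del: plus_fun_apply)
qed

lemma trace_adjoint: "trace (adjoint f) = trace f"
  unfolding trace_def
  by (intro Bochner_Integration.integral_cong) (auto simp: space_M adjoint_def inv_unit unitsD)

text \<open>Over a unit the partner of \<alpha> is its inverse, where the adjoint takes the
  conjugate of f \<alpha>.\<close>

lemma convolution_adjoint_unit:
  assumes f: "f \<in> step_functions" and x: "x \<in> units G"
  shows "convolution G f (adjoint f) x = of_real (\<Sum>\<alpha> | \<alpha> \<in> arrows G \<and> gran G \<alpha> = x \<and> f \<alpha> \<noteq> 0. (cmod (f \<alpha>))\<^sup>2)"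
proof -
  let ?S = "{\<alpha> \<in> arrows G. gran G \<alpha> = x \<and> f \<alpha> \<noteq> 0}"
  have "finite ?S" using row_finite_step_function[OF f] by (simp add: row_finite_def)
  then have "convolution G f (adjoint f) x = (\<Sum>\<alpha>\<in>?S. f \<alpha> * adjoint f (gcomp G (ginv G \<alpha>) x))"
    using x by (intro convolution_eq_sum) (auto simp: unitsD)
  also have "\<dots> = (\<Sum>\<alpha>\<in>?S. of_real ((cmod (f \<alpha>))\<^sup>2))"
  proof (rule sum.cong)
    fix \<alpha> assume \<alpha>: "\<alpha> \<in> ?S"
    then have "gcomp G (ginv G \<alpha>) x = ginv G \<alpha>"
      using comp_dom[of "ginv G \<alpha>"] by (simp add: inv_closed dom_inv)
    then show "f \<alpha> * adjoint f (gcomp G (ginv G \<alpha>) x) = of_real ((cmod (f \<alpha>))\<^sup>2)"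
      using \<alpha> by (simp add: adjoint_def inv_closed inv_inv complex_norm_square[symmetric] del: of_real_power)
  qed simp
  finally show ?thesis by simp
qed

lemma Re_convolution_adjoint_nonneg:
  assumes "f \<in> step_functions" "x \<in> units G"
  shows "Re (convolution G f (adjoint f) x) \<ge> 0"
  by (simp add: convolution_adjoint_unit[OF assms] sum_nonneg)

lemma trace_nonneg: "f \<in> step_functions \<Longrightarrow> trace (convolution G f (adjoint f)) \<ge> 0"
  unfolding trace_def
  by (intro Bochner_Integration.integral_nonneg) (simp add: Re_convolution_adjoint_nonneg space_M)

text \<open>The integrand is a finite sum of squares over each unit, so the set where it does not
  vanish is exactly the range of the support; in particular that set is measurable.\<close>

lemma gran_supp_null:
  assumes f: "f \<in> step_functions" and "trace (convolution G f (adjoint f)) = 0"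
  shows "emeasure M (gran G ` supp f) = 0"
proof -
  let ?h = "\<lambda>x. Re (convolution G f (adjoint f) x)"
  have int: "integrable M ?h"
    using f by (intro integrable_Re convolution_closed adjoint_closed)
  have "AE x in M. ?h x \<ge> 0" by (rule AE_I2) (simp add: space_M f Re_convolution_adjoint_nonneg)
  then have "AE x in M. ?h x = 0"
    using assms(2) integral_nonneg_eq_0_iff_AE[OF int] by (simp add: trace_def)
  then have "emeasure M {x \<in> space M. ?h x \<noteq> 0} = 0"
    using AE_iff_measurable[of "{x \<in> space M. ?h x \<noteq> 0}" M "\<lambda>x. ?h x = 0"] int by simp
  moreover have "{x \<in> space M. ?h x \<noteq> 0} = gran G ` supp f"
  proof -
    have "?h x \<noteq> 0 \<longleftrightarrow> x \<in> gran G ` supp f" if "x \<in> units G" for x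
    proof -
      let ?S = "{\<alpha> \<in> arrows G. gran G \<alpha> = x \<and> f \<alpha> \<noteq> 0}"
      have "finite ?S" using row_finite_step_function[OF f] by (simp add: row_finite_def)
      then have "?h x = 0 \<longleftrightarrow> ?S = {}"
        by (simp add: convolution_adjoint_unit[OF f that] sum_nonneg_eq_0_iff)
      also have "\<dots> \<longleftrightarrow> x \<notin> gran G ` supp f"
        using step_functions_outside[OF f] by (auto simp: supp_def)
      finally show ?thesis by blast
    qed
    moreover have "gran G ` supp f \<subseteq> units G"
      using step_functions_outside[OF f] ran_in_units by (auto simp: supp_def)
    ultimately show ?thesis by (auto simp: space_M)
  qed
  ultimately show ?thesis by simp
qed

text \<open>Boundedness is proved by adding one term at a time: right multiplication by a multiple
  of an indicator is bounded by the partial isometry estimate, and sums of bounded elements stay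
  bounded.\<close>

theorem bounded_tracial_star_algebra_step_functions:
  assumes faithful: "\<And>f :: 'a \<Rightarrow> complex. \<lbrakk>f \<in> step_functions; f \<noteq> 0\<rbrakk> \<Longrightarrow> emeasure M (gran G ` supp f) > 0"
  shows "bounded_tracial_star_algebra step_functions (convolution G) adjoint trace"
proof -
  have scaleR: "r *\<^sub>R f = (\<lambda>\<gamma>. of_real r * f \<gamma>)" for r and f :: "'a \<Rightarrow> complex"
    by (simp add: fun_eq_iff scaleR_conv_of_real)
  interpret tracial_star_algebra step_functions "convolution G" adjoint trace
  proof
    show "subspace (step_functions :: ('a \<Rightarrow> complex) set)"
      by (intro subspaceI) (simp_all add: scaleR step_functions_0 step_functions_add step_functions_smult)
    show "f = 0" if "f \<in> step_functions" "trace (convolution G f (adjoint f)) = 0" for f :: "'a \<Rightarrow> complex"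
      using gran_supp_null[OF that] faithful[OF that(1)] by auto
    show "convolution G (r *\<^sub>R f) g = r *\<^sub>R convolution G f g"
      "convolution G f (r *\<^sub>R g) = r *\<^sub>R convolution G f g" if "f \<in> step_functions" for r and f g :: "'a \<Rightarrow> complex"
      using convolution_smult[OF row_finite_step_function[OF that], of "of_real r" 1 g]
        convolution_smult[OF row_finite_step_function[OF that], of 1 "of_real r" g]
      by (simp_all add: scaleR)
    show "adjoint (r *\<^sub>R f) = r *\<^sub>R adjoint f" for r and f :: "'a \<Rightarrow> complex"
      by (simp add: adjoint_def fun_eq_iff scaleR_conv_of_real)
  qed (simp_all add: convolution_closed convolution_step_add_left convolution_step_add_right
      convolution_assoc adjoint_closed adjoint_add adjoint_adjoint adjoint_convolution
      trace_add trace_scaleR trace_convolution_commute trace_adjoint trace_nonneg del: plus_fun_apply)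
  show ?thesis
  proof
    fix f :: "'a \<Rightarrow> complex" assume "f \<in> step_functions"
    then show "\<exists>B. \<forall>x\<in>step_functions. nrm (convolution G x f) \<le> B * nrm x"
    proof (induction f rule: step_functions_induct)
      case zero
      have "\<forall>x\<in>step_functions. nrm (convolution G x 0) \<le> 0 * nrm x"
        unfolding convolution_0 by (simp add: nrm_def convolution_0 tr_0)
      then show ?case by blast
    next
      case (add c U f)
      note U = add(1) set_inv_compact_open_bisections[OF add(1)]
      note O = compact_open_bisectionsD(1)[OF U(1)]
      let ?p = "indicator (gran G ` U) :: 'a \<Rightarrow> complex"
      \<comment> \<open>The range of U is again a compact open bisection because it is the product
        of U and its inverse.\<close>
      have rU: "set_comp G U (set_inv G U) = gran G ` U" "gran G ` U \<in> compact_open_bisections G"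
        using set_comp_set_inv_self(1)[OF O] set_comp_compact_open_bisections[OF U] by simp_all
      have unit: "gran G ` U \<subseteq> units G" using open_bisectionsD(4)[OF O] ran_in_units by blast
      have "set_comp G (gran G ` U) (gran G ` U) = gran G ` U"
        using unit by (rule set_comp_units)
      then have pp: "convolution G ?p ?p = ?p"
        using convolution_smult_indicator[OF rU(2) rU(2), of 1 1] by simp
      have "set_inv G (gran G ` U) = gran G ` U"
        using unit by (rule set_inv_units)
      then have ps: "adjoint ?p = ?p"
        using adjoint_indicator[OF rU(2), of 1] by simp
      have p: "?p \<in> step_functions"
        using step_functions_indicator[OF rU(2), of 1] by simp
      let ?a = "\<lambda>\<gamma>. c * indicator U \<gamma>"
      have a: "?a \<in> step_functions" by (rule step_functions_indicator[OF U(1)])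
      have "convolution G ?a (adjoint ?a) = (cmod c)\<^sup>2 *\<^sub>R ?p"
        using U rU by (simp add: adjoint_indicator convolution_smult_indicator scaleR complex_norm_square del: of_real_power)
      note bd = nrm_mul_partial_isometry_le[OF a this p pp ps]
      obtain B where "\<forall>x\<in>step_functions. nrm (convolution G x f) \<le> B * nrm x"
        using add by blast
      then have "\<forall>x\<in>step_functions. nrm (convolution G x (?a + f)) \<le> (2 * \<bar>(cmod c)\<^sup>2\<bar> + 2 * B) * nrm x"
        using nrm_mul_add_le[OF a add(2)] bd by blast
      then show ?case by blast
    qed
  qed
qed

end

end

section \<open>Transfer to integral domains of characteristic zero\<close>

definition related_functions :: "('k \<times> 'l) set \<Rightarrow> ('g \<Rightarrow> 'k) \<Rightarrow> ('g \<Rightarrow> 'l) \<Rightarrow> bool" where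
  "related_functions \<Gamma> f g \<longleftrightarrow> (\<forall>\<gamma>. (f \<gamma>, g \<gamma>) \<in> \<Gamma>)"

text \<open>Only entries inside the block are compared: beyond it, the extensional matrices are
  \<open>undefined\<close> while the complex ones are zero.\<close>

definition related_matrices ::
    "nat \<Rightarrow> ('k \<times> 'l) set \<Rightarrow> (nat \<times> nat \<Rightarrow> 'g \<Rightarrow> 'k) \<Rightarrow> (nat \<Rightarrow> nat \<Rightarrow> 'g \<Rightarrow> 'l) \<Rightarrow> bool" where
  "related_matrices n \<Gamma> F H \<longleftrightarrow> (\<forall>i<n. \<forall>j<n. related_functions \<Gamma> (F (i, j)) (H i j))"

text \<open>The index set of \<open>convolution\<close> depends on which products vanish. Since zero
  corresponds only to zero, both sides sum over the same set, and an infinite one yields 0 on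
  both.\<close>

lemma related_convolution:
  assumes "partial_ring_iso \<Gamma>" "related_functions \<Gamma> f f'" "related_functions \<Gamma> g g'"
  shows "related_functions \<Gamma> (convolution G f g) (convolution G f' g')"
proof -
  interpret partial_ring_iso \<Gamma> by fact
  have prod: "(f \<alpha> * g \<beta>, f' \<alpha> * g' \<beta>) \<in> \<Gamma>" for \<alpha> \<beta>
    using assms by (intro mult) (auto simp: related_functions_def)
  have "f \<alpha> * g \<beta> = 0 \<longleftrightarrow> f' \<alpha> * g' \<beta> = 0" for \<alpha> \<beta>
    using zero_iff[OF prod] .
  then show ?thesis
    unfolding related_functions_def convolution_def
    by (auto intro!: sum prod simp del: mult_eq_0_iff)
qed

lemma (in partial_ring_iso) related_functions_sum:
  assumes "\<And>i. i \<in> I \<Longrightarrow> related_functions \<Gamma> (f i) (g i)"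
  shows "related_functions \<Gamma> (\<lambda>\<gamma>. \<Sum>i\<in>I. f i \<gamma>) (\<lambda>\<gamma>. \<Sum>i\<in>I. g i \<gamma>)"
  using assms by (auto simp: related_functions_def intro: sum)

lemma (in partial_ring_iso) related_functions_eq:
  assumes "related_functions \<Gamma> f f'" "related_functions \<Gamma> g g'"
  shows "f = g \<longleftrightarrow> f' = g'"
  using assms eq_iff by (fastforce simp: related_functions_def fun_eq_iff)

context ample_groupoid
begin

lemma finsum_groupoid_algebra:
  fixes f :: "'i \<Rightarrow> 'a \<Rightarrow> 'k::comm_ring_1"
  assumes "finite I" "\<And>i. i \<in> I \<Longrightarrow> f i \<in> step_functions"
  shows "finsum (groupoid_algebra G) f I = (\<lambda>\<gamma>. \<Sum>i\<in>I. f i \<gamma>)"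
proof -
  let ?R = "groupoid_algebra G :: ('a \<Rightarrow> 'k) ring"
  have R: "carrier ?R = step_functions" "zero ?R = 0" "add ?R = (\<lambda>f g. f + g)"
    by (simp_all add: step_functions_def) (simp_all add: groupoid_algebra_def fun_eq_iff)
  interpret abelian_monoid ?R
    by (rule abelian_monoidI) (simp_all add: R step_functions_add step_functions_0 add_ac)
  show ?thesis
    using assms
  proof (induction I)
    case empty
    then show ?case by (simp only: finsum_empty R(2)) (simp add: fun_eq_iff)
  next
    case (insert i I)
    then show ?case
      by (subst finsum_insert) (auto simp: R fun_eq_iff)
  qed
qed

text \<open>S is fixed before \<Gamma>, so the coefficients of several functions can be collected
  first and one \<Gamma> chosen for all of them.\<close>

lemma coefficients_step_function:
  assumes "f \<in> step_functions"
  obtains S where "finite S"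
    "\<And>\<Gamma> :: ('k::idom \<times> complex) set. \<lbrakk>partial_ring_iso \<Gamma>; S \<subseteq> fst ` \<Gamma>\<rbrakk> \<Longrightarrow> \<exists>f'\<in>step_functions. related_functions \<Gamma> f f'"
proof -
  have "\<exists>S. finite S \<and> (\<forall>\<Gamma> :: ('k \<times> complex) set. partial_ring_iso \<Gamma> \<longrightarrow> S \<subseteq> fst ` \<Gamma> \<longrightarrow>
      (\<exists>f'\<in>step_functions. related_functions \<Gamma> f f'))"
    using assms
  proof (induction f rule: step_functions_induct)
    case zero
    have "related_functions \<Gamma> (0 :: 'a \<Rightarrow> 'k) (0 :: 'a \<Rightarrow> complex)"
      if "partial_ring_iso \<Gamma>" for \<Gamma> :: "('k \<times> complex) set"
      using partial_ring_iso.zero[OF that] by (simp add: related_functions_def)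
    then show ?case using step_functions_0 by (intro exI[of _ "{}"]) blast
  next
    case (add c U f)
    then obtain S where S: "finite S" "\<And>\<Gamma> :: ('k \<times> complex) set. \<lbrakk>partial_ring_iso \<Gamma>; S \<subseteq> fst ` \<Gamma>\<rbrakk> \<Longrightarrow>
        \<exists>f'\<in>step_functions. related_functions \<Gamma> f f'" by blast
    have "\<exists>f'\<in>step_functions. related_functions \<Gamma> ((\<lambda>\<gamma>. c * indicator U \<gamma>) + f) f'"
      if \<Gamma>: "partial_ring_iso \<Gamma>" "insert c S \<subseteq> fst ` \<Gamma>" for \<Gamma> :: "('k \<times> complex) set"
    proof -
      interpret iso: partial_ring_iso \<Gamma> by fact
      obtain f' where f': "f' \<in> step_functions" "related_functions \<Gamma> f f'" using S(2) \<Gamma> by blast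
      obtain c' where c': "(c, c') \<in> \<Gamma>" using \<Gamma>(2) by auto
      have "(indicator U \<gamma>, indicator U \<gamma>) \<in> \<Gamma>" for \<gamma>
        using iso.one iso.zero by (simp add: indicator_def)
      then have "related_functions \<Gamma> ((\<lambda>\<gamma>. c * indicator U \<gamma>) + f) ((\<lambda>\<gamma>. c' * indicator U \<gamma>) + f')"
        using f' c' unfolding related_functions_def plus_fun_apply by (blast intro: iso.add iso.mult)
      moreover have "(\<lambda>\<gamma>. c' * indicator U \<gamma>) + f' \<in> step_functions"
        using add(1) f'(1) by (rule step_functions_add_indicator)
      ultimately show ?thesis by blast
    qed
    then show ?case using S(1) by (intro exI[of _ "insert c S"]) blast
  qed
  then show thesis using that by blast
qed

text \<open>Only e and the middle factors x, y of u = e x e and v = e y e are given complex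
  counterparts; everything else is a product of these, and the relation respects products and
  detects equality.\<close>

lemma stably_finite_groupoid_algebra:
  assumes "bounded_tracial_star_algebra (step_functions :: ('a \<Rightarrow> complex) set) (convolution G) star tr"
  shows "stably_finite (groupoid_algebra G :: ('a \<Rightarrow> 'k::{idom, ring_char_0}) ring)"
  unfolding stably_finite_def dedekind_finite_def
proof (intro allI impI ballI)
  interpret C: bounded_tracial_star_algebra "step_functions :: ('a \<Rightarrow> complex) set" "convolution G" star tr
    by fact
  fix n :: nat and e u v
  let ?R = "groupoid_algebra G :: ('a \<Rightarrow> 'k) ring"
  let ?M = "matrix_ring n ?R"
  interpret CM: bounded_tracial_star_algebra "C.matrices n" "C.matrix_mul n" C.matrix_star "C.matrix_tr n"
    by (rule C.bounded_tracial_star_algebra_matrices)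
  assume e: "e \<in> carrier ?M" "e \<otimes>\<^bsub>?M\<^esub> e = e" and u: "u \<in> corner ?M e" and v: "v \<in> corner ?M e"
    and uv: "u \<otimes>\<^bsub>?M\<^esub> v = e"
  obtain x where x: "x \<in> carrier ?M" "u = e \<otimes>\<^bsub>?M\<^esub> x \<otimes>\<^bsub>?M\<^esub> e" using u by (auto simp: corner_def)
  obtain y where y: "y \<in> carrier ?M" "v = e \<otimes>\<^bsub>?M\<^esub> y \<otimes>\<^bsub>?M\<^esub> e" using v by (auto simp: corner_def)
  have carrier_M: "carrier ?M = {..<n} \<times> {..<n} \<rightarrow>\<^sub>E step_functions"
    by (simp add: matrix_ring_def step_functions_def)
  have mult_M: "(F \<otimes>\<^bsub>?M\<^esub> H) (i, j) = (\<lambda>\<gamma>. \<Sum>k<n. convolution G (F (i, k)) (H (k, j)) \<gamma>)"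
    if "F \<in> carrier ?M" "H \<in> carrier ?M" "i < n" "j < n" for F H i j
  proof -
    have "(F \<otimes>\<^bsub>?M\<^esub> H) (i, j) = finsum ?R (\<lambda>k. convolution G (F (i, k)) (H (k, j))) {..<n}"
      using that(3,4) by (simp add: matrix_ring_def groupoid_algebra_def)
    also have "\<dots> = (\<lambda>\<gamma>. \<Sum>k<n. convolution G (F (i, k)) (H (k, j)) \<gamma>)"
      using that by (intro finsum_groupoid_algebra convolution_closed) (auto simp: carrier_M PiE_iff)
    finally show ?thesis .
  qed
  have mult_M_closed: "F \<otimes>\<^bsub>?M\<^esub> H \<in> carrier ?M" if "F \<in> carrier ?M" "H \<in> carrier ?M" for F H
  proof -
    have "(F \<otimes>\<^bsub>?M\<^esub> H) (i, j) \<in> step_functions" if "i < n" "j < n" for i j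
      unfolding mult_M[OF \<open>F \<in> _\<close> \<open>H \<in> _\<close> that] sum_fun_eq[symmetric]
      using \<open>F \<in> _\<close> \<open>H \<in> _\<close> that
      by (intro step_functions_sum convolution_closed) (auto simp: carrier_M PiE_iff)
    moreover have "(F \<otimes>\<^bsub>?M\<^esub> H) \<in> extensional ({..<n} \<times> {..<n})"
      by (simp add: matrix_ring_def)
    ultimately show ?thesis by (auto simp: carrier_M PiE_iff)
  qed
  have "\<exists>S. finite S \<and> (\<forall>\<Gamma> :: ('k \<times> complex) set. partial_ring_iso \<Gamma> \<longrightarrow> S \<subseteq> fst ` \<Gamma> \<longrightarrow>
      (\<exists>F'\<in>C.matrices n. related_matrices n \<Gamma> F F'))" if F: "F \<in> carrier ?M" for F
  proof -
    have "\<forall>p\<in>{..<n} \<times> {..<n}. \<exists>S. finite S \<and> (\<forall>\<Gamma> :: ('k \<times> complex) set. partial_ring_iso \<Gamma> \<longrightarrow> S \<subseteq> fst ` \<Gamma> \<longrightarrow>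
      (\<exists>f'\<in>step_functions. related_functions \<Gamma> (F p) f'))"
    proof
      fix p assume "p \<in> {..<n} \<times> {..<n}"
      then have "F p \<in> step_functions" using F by (auto simp: carrier_M PiE_iff)
      then show "\<exists>S. finite S \<and> (\<forall>\<Gamma> :: ('k \<times> complex) set. partial_ring_iso \<Gamma> \<longrightarrow> S \<subseteq> fst ` \<Gamma> \<longrightarrow>
          (\<exists>f'\<in>step_functions. related_functions \<Gamma> (F p) f'))"
        using coefficients_step_function[of "F p"] by metis
    qed
    then obtain S where S: "\<And>p. p \<in> {..<n} \<times> {..<n} \<Longrightarrow> finite (S p)"
      "\<And>p \<Gamma>. \<lbrakk>p \<in> {..<n} \<times> {..<n}; partial_ring_iso \<Gamma>; S p \<subseteq> fst ` \<Gamma>\<rbrakk> \<Longrightarrow>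
        \<exists>f'\<in>step_functions. related_functions (\<Gamma> :: ('k \<times> complex) set) (F p) f'"
      by metis
    show ?thesis
    proof (intro exI[of _ "\<Union>p\<in>{..<n} \<times> {..<n}. S p"] conjI allI impI)
      show "finite (\<Union>p\<in>{..<n} \<times> {..<n}. S p)" using S(1) by blast
      fix \<Gamma> :: "('k \<times> complex) set"
      assume \<Gamma>: "partial_ring_iso \<Gamma>" "(\<Union>p\<in>{..<n} \<times> {..<n}. S p) \<subseteq> fst ` \<Gamma>"
      have "\<forall>p\<in>{..<n} \<times> {..<n}. \<exists>f'. f' \<in> step_functions \<and> related_functions \<Gamma> (F p) f'"
      proof
        fix p assume p: "p \<in> {..<n} \<times> {..<n}"
        then have "S p \<subseteq> fst ` \<Gamma>" using \<Gamma>(2) by (rule SUP_upper[THEN subset_trans])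
        from S(2)[OF p \<Gamma>(1) this] show "\<exists>f'. f' \<in> step_functions \<and> related_functions \<Gamma> (F p) f'"
          by blast
      qed
      from bchoice[OF this] obtain h
        where h: "\<forall>p\<in>{..<n} \<times> {..<n}. h p \<in> step_functions \<and> related_functions \<Gamma> (F p) (h p)" ..
      define F' where "F' = (\<lambda>i j. if i < n \<and> j < n then h (i, j) else 0)"
      have "F' \<in> C.matrices n" "related_matrices n \<Gamma> F F'"
        using h C.zero_closed by (auto simp: F'_def C.matrices_def related_matrices_def)
      then show "\<exists>F'\<in>C.matrices n. related_matrices n \<Gamma> F F'" by blast
    qed
  qed
  then obtain S where S: "\<And>F. F \<in> carrier ?M \<Longrightarrow> finite (S F)"
    "\<And>F \<Gamma>. \<lbrakk>F \<in> carrier ?M; partial_ring_iso \<Gamma>; S F \<subseteq> fst ` \<Gamma>\<rbrakk> \<Longrightarrow>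
      \<exists>F'\<in>C.matrices n. related_matrices n (\<Gamma> :: ('k \<times> complex) set) F F'"
    by metis
  obtain \<Gamma> :: "('k \<times> complex) set" where \<Gamma>: "partial_ring_iso \<Gamma>" "S e \<union> S x \<union> S y \<subseteq> fst ` \<Gamma>"
    using finite_set_in_partial_ring_iso[of "S e \<union> S x \<union> S y"] S(1) e(1) x(1) y(1) by auto
  interpret iso: partial_ring_iso \<Gamma> by fact
  let ?rel = "related_matrices n \<Gamma>"
  obtain e' x' y' where C: "e' \<in> C.matrices n" "x' \<in> C.matrices n" "y' \<in> C.matrices n"
    and rel: "?rel e e'" "?rel x x'" "?rel y y'"
    using S(2)[OF e(1) \<Gamma>(1)] S(2)[OF x(1) \<Gamma>(1)] S(2)[OF y(1) \<Gamma>(1)] \<Gamma>(2) by auto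
  have rel_mult: "?rel (F \<otimes>\<^bsub>?M\<^esub> H) (C.matrix_mul n F' H')"
    if "F \<in> carrier ?M" "H \<in> carrier ?M" "?rel F F'" "?rel H H'" for F H F' H'
    unfolding related_matrices_def
  proof (intro allI impI)
    fix i j assume ij: "i < n" "j < n"
    have "related_functions \<Gamma> (convolution G (F (i, k)) (H (k, j))) (convolution G (F' i k) (H' k j))" if "k < n" for k
      using that(1) \<open>?rel F F'\<close> \<open>?rel H H'\<close> ij
      by (intro related_convolution[OF \<Gamma>(1)]) (auto simp: related_matrices_def)
    then have "related_functions \<Gamma> (\<lambda>\<gamma>. \<Sum>k<n. convolution G (F (i, k)) (H (k, j)) \<gamma>)
        (\<lambda>\<gamma>. \<Sum>k<n. convolution G (F' i k) (H' k j) \<gamma>)"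
      by (intro iso.related_functions_sum) simp
    then show "related_functions \<Gamma> ((F \<otimes>\<^bsub>?M\<^esub> H) (i, j)) (C.matrix_mul n F' H' i j)"
      using mult_M[OF that(1,2) ij] by (simp add: C.matrix_mul_def sum_fun_eq)
  qed
  \<comment> \<open>Used left to right to export the hypotheses on e, u, v, and right to left to
    bring the conclusion back.\<close>
  have rel_eq: "F = H \<longleftrightarrow> F' = H'"
    if "F \<in> carrier ?M" "H \<in> carrier ?M" "?rel F F'" "?rel H H'" "F' \<in> C.matrices n" "H' \<in> C.matrices n" for F H F' H'
  proof -
    have entry: "F (i, j) = H (i, j) \<longleftrightarrow> F' i j = H' i j" if "i < n" "j < n" for i j
      using \<open>?rel F F'\<close> \<open>?rel H H'\<close> that
      by (intro iso.related_functions_eq) (simp_all add: related_matrices_def)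
    have "F = H \<longleftrightarrow> (\<forall>i<n. \<forall>j<n. F (i, j) = H (i, j))"
    proof
      assume "\<forall>i<n. \<forall>j<n. F (i, j) = H (i, j)"
      then show "F = H"
        using that(1,2) unfolding carrier_M by (intro PiE_ext[of F _ _ H]) auto
    qed simp
    also have "\<dots> \<longleftrightarrow> (\<forall>i<n. \<forall>j<n. F' i j = H' i j)"
      by (simp add: entry)
    also have "\<dots> \<longleftrightarrow> F' = H'"
    proof
      assume eq: "\<forall>i<n. \<forall>j<n. F' i j = H' i j"
      have "F' i j = H' i j" for i j
        using that(5,6) eq by (cases "i < n \<and> j < n") (auto simp: C.matrices_def)
      then show "F' = H'" by blast
    qed simp
    finally show ?thesis .
  qed
  \<comment> \<open>Built by the same formula from e' and x', so membership in the complex corner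
    follows once e' is idempotent.\<close>
  define u' where "u' = C.matrix_mul n (C.matrix_mul n e' x') e'"
  define v' where "v' = C.matrix_mul n (C.matrix_mul n e' y') e'"
  have M: "u \<in> carrier ?M" "v \<in> carrier ?M" and C': "u' \<in> C.matrices n" "v' \<in> C.matrices n"
    and rel': "?rel u u'" "?rel v v'"
    unfolding x(2) y(2) u'_def v'_def
    using e(1) x(1) y(1) C rel by (auto intro!: mult_M_closed CM.mul_closed rel_mult)
  have ee: "C.matrix_mul n e' e' = e'"
    using rel_eq[OF mult_M_closed[OF e(1,1)] e(1) rel_mult[OF e(1,1) rel(1,1)] rel(1)
        CM.mul_closed[OF C(1,1)] C(1)] e(2) by simp
  have absorb: "C.matrix_mul n e' (C.matrix_mul n e' z) = C.matrix_mul n e' z" if "z \<in> C.matrices n" for z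
    using CM.mul_assoc[OF C(1) C(1) that] ee by simp
  have corner': "C.matrix_mul n e' u' = u'" "C.matrix_mul n u' e' = u'"
    "C.matrix_mul n e' v' = v'" "C.matrix_mul n v' e' = v'"
    using C by (simp_all add: u'_def v'_def CM.mul_assoc CM.mul_closed absorb ee)
  have "C.matrix_mul n u' v' = e'"
    using rel_eq[OF mult_M_closed[OF M] e(1) rel_mult[OF M rel'] rel(1) CM.mul_closed[OF C'] C(1)] uv by simp
  then have "C.matrix_mul n v' u' = e'"
    by (rule CM.left_inverse_eq_right_inverse[OF C(1) C' ee corner'])
  then show "v \<otimes>\<^bsub>?M\<^esub> u = e"
    using rel_eq[OF mult_M_closed[OF M(2,1)] e(1) rel_mult[OF M(2,1) rel'(2,1)] rel(1)
        CM.mul_closed[OF C'(2,1)] C(1)] by simp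
qed

end

theorem corollary7p7:
  fixes G :: "'g top_groupoid"
  assumes "ample_groupoid G"
    and "\<exists>\<mu>. invariant_mean G \<mu> \<and> strongly_faithful G \<mu>"
  shows "stably_finite (groupoid_algebra G :: ('g \<Rightarrow> 'k::{idom, ring_char_0}) ring)"
proof -
  interpret ample_groupoid G by fact
  obtain M where M: "invariant_measure G M"
    and faithful: "\<And>f :: 'g \<Rightarrow> complex. \<lbrakk>f \<in> step_functions; f \<noteq> (\<lambda>\<gamma>. 0)\<rbrakk> \<Longrightarrow> emeasure M (gran G ` supp f) > 0"
    using assms(2) unfolding strongly_faithful_def step_functions_def by blast
  have "bounded_tracial_star_algebra (step_functions :: ('g \<Rightarrow> complex) set) (convolution G) adjoint (trace M)"
    using faithful by (intro bounded_tracial_star_algebra_step_functions[OF M]) (simp add: zero_fun_def)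
  then show ?thesis by (rule stably_finite_groupoid_algebra)
qed

end
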